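(* Let $\gamma,g>0$ and let $\pi$ be the unique stationary distribution of the inert drift process $(H_t,V_t)$ with parameters $\gamma,g$ (defined in the context). There exist positive constants $y'(\gamma,g),c',c$ (depending only on $\gamma,g$) such that for all $y>y'(\gamma,g)$, $$e^{-c'}\,e^{-4(1+\gamma)\left(y+\frac{g}{1+\gamma}\right)^2}\le \pi\left(\mathbb{R}_+\times(y,\infty)\right)\le e^{c}\,e^{-\frac{1+\gamma}{8}\left(y+\frac{g}{1+\gamma}\right)^2}.$$ Also, there exist positive constants $x'(\gamma,g),C',C$ (depending only on $\gamma,g$) such that for all $x>x'(\gamma,g)$, $$e^{-C'}\,e^{-\frac{4gx}{\gamma}}\le \pi\left((x,\infty)\times\mathbb{R}\right)\le e^{C}\,e^{-\frac{gx}{32\gamma}}.$$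
   Context: Fix $\gamma>0$ and $g>0$. Write $\mathbb{R}_+=[0,\infty)$ and $S=\mathbb{R}_+\times(-g/\gamma,\infty)$. Let $B$ be a one-dimensional standard Brownian motion with $B_0=0$. For $(h,\nu)\in S$, the inert drift process $(H_t,V_t)_{t\ge 0}$ is the continuous $S$-valued process that is the (pathwise unique, strong) solution of $$dH_t=V_t\,dt-dB_t+dL_t,\qquad dV_t=-(\gamma V_t+g)\,dt+dL_t,\qquad (H_0,V_0)=(h,\nu),$$ where $L$ is the unique continuous, non-negative, non-decreasing process such that $\int_0^t \mathbf 1_{\{H_u=0\}}\,dL_u=L_t$ and $H_t\ge 0$ for all $t\ge 0$. It has the representation $L_t=\sup_{u\le t}\left(-h+B_u-\int_0^u V_w\,dw\right)\vee 0$, and $(H,V)$ is a strong Markov process. It has a unique stationary distribution, denoted $\pi$, a probability measure on $S$; it is regarded as a measure on $\mathbb{R}_+\times\mathbb{R}$ giving no mass to the complement of $S$. *)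

theory Defs
  imports "HOL-Probability.Probability"
begin

text \<open>Continuous time is the half-line \<open>{0..}\<close> of \<^typ>\<open>real\<close>; values of processes at negative
  times are junk and never constrained.\<close>

locale brownian_motion = prob_space M for M :: "'a measure" +
  fixes B :: "real \<Rightarrow> 'a \<Rightarrow> real"
  assumes measurable_B: "\<And>t. 0 \<le> t \<Longrightarrow> B t \<in> borel_measurable M"
    and AE_start: "AE \<omega> in M. B 0 \<omega> = 0"
    and AE_continuous: "AE \<omega> in M. continuous_on {0..} (\<lambda>t. B t \<omega>)"
    and normal_increments: "\<And>s t. 0 \<le> s \<Longrightarrow> s < t \<Longrightarrow>
      distributed M lborel (\<lambda>\<omega>. B t \<omega> - B s \<omega>) (normal_density 0 (sqrt (t - s)))"
    and indep_increments: "\<And>(n::nat) (\<tau>::nat \<Rightarrow> real). 0 \<le> \<tau> 0 \<Longrightarrow> strict_mono_on {..n} \<tau> \<Longrightarrow>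
      indep_vars (\<lambda>_. borel) (\<lambda>i \<omega>. B (\<tau> (Suc i)) \<omega> - B (\<tau> i) \<omega>) {..<n}"

definition state_space :: "real \<Rightarrow> real \<Rightarrow> (real \<times> real) set" where
  "state_space \<gamma> g = {0..} \<times> {- g / \<gamma> <..}"

text \<open>The noise being additive, the equations
  \<open>dH = V dt - dB + dL\<close> and \<open>dV = -(\<gamma> V + g) dt + dL\<close> are imposed in integrated form along a path
  \<open>b\<close> of \<open>B\<close>. The integral against \<open>dL\<close> is a Lebesgue--Stieltjes integral; \<open>L\<close> is extended
  by the constant \<open>L 0\<close> to the left of \<open>0\<close>, so that \<open>dL\<close> has no mass there.\<close>

definition inert_drift_path ::
  "real \<Rightarrow> real \<Rightarrow> real \<times> real \<Rightarrow> (real \<Rightarrow> real) \<Rightarrow>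
   (real \<Rightarrow> real) \<Rightarrow> (real \<Rightarrow> real) \<Rightarrow> (real \<Rightarrow> real) \<Rightarrow> bool" where
  "inert_drift_path \<gamma> g z b H V L \<longleftrightarrow>
     continuous_on {0..} H \<and> continuous_on {0..} V \<and> continuous_on {0..} L \<and>
     (\<forall>t\<ge>0. (H t, V t) \<in> state_space \<gamma> g) \<and>
     (H 0, V 0) = z \<and>
     (\<forall>t\<ge>0. H t = fst z + integral {0..t} V - b t + L t) \<and>
     (\<forall>t\<ge>0. V t = snd z - integral {0..t} (\<lambda>s. \<gamma> * V s + g) + L t) \<and>
     (\<forall>t\<ge>0. 0 \<le> L t) \<and> mono_on {0..} L \<and>
     (\<forall>t\<ge>0. (LINT u:{0..t}|interval_measure (\<lambda>s. L (max 0 s)). indicator {u. H u = 0} u) = L t)"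

text \<open>Adaptedness of \<open>H\<close>, \<open>V\<close>, \<open>L\<close> is not listed: the path equations have at most one solution for
  each path of \<open>B\<close>, so up to null sets the solution is a functional of \<open>B\<close>.\<close>

definition inert_drift_process ::
  "'a measure \<Rightarrow> (real \<Rightarrow> 'a \<Rightarrow> real) \<Rightarrow> real \<Rightarrow> real \<Rightarrow> real \<times> real \<Rightarrow>
   (real \<Rightarrow> 'a \<Rightarrow> real) \<Rightarrow> (real \<Rightarrow> 'a \<Rightarrow> real) \<Rightarrow> (real \<Rightarrow> 'a \<Rightarrow> real) \<Rightarrow> bool" where
  "inert_drift_process M B \<gamma> g z H V L \<longleftrightarrow>
     (\<forall>t\<ge>0. H t \<in> borel_measurable M \<and> V t \<in> borel_measurable M \<and> L t \<in> borel_measurable M) \<and>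
     (AE \<omega> in M. inert_drift_path \<gamma> g z (\<lambda>t. B t \<omega>) (\<lambda>t. H t \<omega>) (\<lambda>t. V t \<omega>) (\<lambda>t. L t \<omega>))"

text \<open>Invariance of \<open>\<pi>\<close> under the transition function
  \<open>(t, z, A) \<mapsto> P ((H\<^sub>t, V\<^sub>t) \<in> A)\<close>, where \<open>(H, V)\<close> starts from \<open>z\<close>. The transition function
  depends only on \<open>\<gamma>\<close> and \<open>g\<close>, so the choice of the probability space is immaterial. Its sample
  space is taken of type \<^typ>\<open>real \<Rightarrow> real\<close>, with an arbitrary \<open>\<sigma>\<close>-algebra; this type
  carries Wiener measure, and fixing it makes stationarity a property of \<open>\<gamma>\<close>, \<open>g\<close>, \<open>\<pi>\<close> alone.\<close>

definition inert_drift_stationary :: "real \<Rightarrow> real \<Rightarrow> (real \<times> real) measure \<Rightarrow> bool" where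
  "inert_drift_stationary \<gamma> g \<pi> \<longleftrightarrow>
     prob_space \<pi> \<and> sets \<pi> = sets borel \<and> emeasure \<pi> (- state_space \<gamma> g) = 0 \<and>
     (\<exists>(M :: (real \<Rightarrow> real) measure) B H V L.
        brownian_motion M B \<and>
        (\<forall>z\<in>state_space \<gamma> g. inert_drift_process M B \<gamma> g z (H z) (V z) (L z)) \<and>
        (\<forall>t\<ge>0. \<forall>A\<in>sets borel.
           emeasure \<pi> A =
             (\<integral>\<^sup>+z\<in>state_space \<gamma> g. emeasure M {\<omega> \<in> space M. (H z t \<omega>, V z t \<omega>) \<in> A} \<partial>\<pi>)))"

end

theory Submission
  imports Defs
begin

text \<open>Four estimates are proved: an upper and a lower bound for the tail of \<open>V\<close> and for that of
  \<open>H\<close> under an arbitrary stationary law \<open>\<pi>\<close>, with constants that do not depend on \<open>\<pi>\<close>. All of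
  them run the process for one well chosen time \<open>T\<close> from a \<open>\<pi>\<close>-distributed point and compare the
  laws at times \<open>0\<close> and \<open>T\<close>, which agree. Since the noise is additive, each
  comparison reduces to a statement about single paths together with the probability of an explicit
  event for the Brownian motion.

  \<^bold>\<open>Upper bounds.\<close> Write \<open>a = 1 + \<gamma>\<close>. The local time cancels in \<open>V - H\<close>, which satisfies
  \<open>d(V - H) = -(a V + g) dt + dB\<close>. As \<open>V \<ge> V - H\<close>, the quantity \<open>V - H + g/a\<close> is pulled down with speed
  at least \<open>a u / 2\<close> as long as it exceeds \<open>u / 2\<close>, so it can only climb from \<open>u / 2\<close> to
  \<open>u\<close> if \<open>B\<close> beats the line of slope \<open>a u / 4\<close> by \<open>u / 2\<close>; this has
  probability at most of order \<open>exp (- a u\<^sup>2 / 8)\<close>. Moreover \<open>V\<close> relaxes exponentially to \<open>- g / \<gamma>\<close> while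
  \<open>H > 0\<close>, and \<open>V = V - H\<close> at the last zero of \<open>H\<close>. Hence for a fixed large \<open>T\<close>, outside
  that event, \<open>V\<^sub>0 + g/a \<le> 2 u\<close> forces \<open>V\<^sub>T + g/a \<le> u\<close> (\<open>V_le_level\<close>), which gives
  \<open>F u \<le> F (2 u) + K exp (- a u\<^sup>2 / 8)\<close> for the tail \<open>F\<close> of \<open>V + g/a\<close>; iterating this
  inequality (\<open>doubling_bound\<close>) yields the Gaussian bound. The tail of \<open>H\<close> is treated
  in the same way with \<open>T\<close> proportional to the level \<open>x\<close> (\<open>H_le_level\<close>): away from \<open>0\<close>, the process
  \<open>H + V / \<gamma>\<close> is a Brownian motion with drift \<open>- g / \<gamma>\<close>, and at the last zero of \<open>H\<close> it is
  controlled by the bound on \<open>V\<close>.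

  \<^bold>\<open>Lower bounds.\<close> Since \<open>V > - g / \<gamma>\<close>, one has \<open>H\<^sub>T \<ge> - g T / \<gamma> - B\<^sub>T\<close>, and \<open>T = x \<gamma> / g\<close> makes
  \<open>H\<^sub>T > x\<close> cost a Gaussian deviation of size \<open>2 x\<close>. For \<open>V\<close>, if \<open>V\<^sub>T \<le> y\<close> then \<open>V\<close> cannot
  have been much larger than \<open>y\<close> shortly before \<open>T\<close>, which bounds the drift of \<open>V - H\<close>;
  thus a large value of \<open>B\<^sub>T\<close> forces \<open>V\<^sub>T > y\<close> (\<open>V_gt_level\<close>). With \<open>T = 1 / a\<close> the
  Gaussian cost is at most \<open>(11/4)\<^sup>2 a y\<^sup>2 / 2 < 4 a y\<^sup>2\<close> to leading order. The starting point
  only has to satisfy \<open>H\<^sub>0 \<le> R\<close>, an event of \<open>\<pi>\<close>-probability at least \<open>1/2\<close> by the upper bound for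
  \<open>H\<close>.

  The Brownian input consists of the maximal inequality for \<open>exp (c B\<^sub>s - c\<^sup>2 s / 2)\<close>, of its consequence
  \<open>increments_bound\<close> for all increments on \<open>[0, T]\<close> simultaneously, and of a lower bound for
  the normal tail.\<close>

section \<open>Paths of the inert drift process\<close>

locale inert_path =
  fixes \<gamma> g h v :: real and b H V L :: "real \<Rightarrow> real"
  assumes \<gamma>_pos: "0 < \<gamma>" and g_pos: "0 < g"
    and path: "inert_drift_path \<gamma> g (h, v) b H V L"
begin

lemma
  shows continuous_on_H: "continuous_on {0..} H"
    and continuous_on_V: "continuous_on {0..} V"
    and in_state_space: "\<forall>t\<ge>0. (H t, V t) \<in> state_space \<gamma> g"
    and start: "(H 0, V 0) = (h, v)"
    and H_eq_all: "\<forall>t\<ge>0. H t = fst (h, v) + integral {0..t} V - b t + L t"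
    and V_eq_all: "\<forall>t\<ge>0. V t = snd (h, v) - integral {0..t} (\<lambda>s. \<gamma> * V s + g) + L t"
    and mono_on_L: "mono_on {0..} L"
    and L_support_all: "\<forall>t\<ge>0.
      (LINT u:{0..t}|interval_measure (\<lambda>s. L (max 0 s)). indicator {u. H u = 0} u) = L t"
  by (insert path, unfold inert_drift_path_def, (elim conjE, assumption)+)

lemma H_0: "H 0 = h" and V_0: "V 0 = v"
  using start by auto

lemma H_nonneg: "0 \<le> t \<Longrightarrow> 0 \<le> H t" and V_gt: "0 \<le> t \<Longrightarrow> - g / \<gamma> < V t"
  using in_state_space[rule_format, of t] by (auto simp: state_space_def)

lemma H_eq: "0 \<le> t \<Longrightarrow> H t = h + integral {0..t} V - b t + L t"
  using H_eq_all[rule_format, of t] by simp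

lemma L_mono: "0 \<le> s \<Longrightarrow> s \<le> t \<Longrightarrow> L s \<le> L t"
  using mono_onD[OF mono_on_L, of s t] by simp

lemma V_eq:
  assumes "0 \<le> t" shows "V t = v - (\<gamma> * integral {0..t} V + g * t) + L t"
proof -
  have i: "V integrable_on {0..t}"
    by (intro integrable_continuous_real continuous_on_subset[OF continuous_on_V]) auto
  have "integral {0..t} (\<lambda>s. \<gamma> * V s + g) = \<gamma> * integral {0..t} V + g * t"
    using assms integrable_on_cmult_left[OF i, of \<gamma>] by (subst integral_add) auto
  then show ?thesis using V_eq_all[rule_format, of t] assms by simp
qed

lemma V_eq_between:
  assumes "0 \<le> s" "s \<le> t"
  shows "V t - V s = - (\<gamma> * integral {s..t} V + g * (t - s)) + (L t - L s)"
    and "H t - H s = integral {s..t} V - (b t - b s) + (L t - L s)"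
proof -
  have i: "V integrable_on {0..t}"
    by (intro integrable_continuous_real continuous_on_subset[OF continuous_on_V]) auto
  have "integral {0..t} V = integral {0..s} V + integral {s..t} V"
    using Henstock_Kurzweil_Integration.integral_combine[OF assms i] by simp
  then show "V t - V s = - (\<gamma> * integral {s..t} V + g * (t - s)) + (L t - L s)"
    "H t - H s = integral {s..t} V - (b t - b s) + (L t - L s)"
    using V_eq[of s] V_eq[of t] H_eq[of s] H_eq[of t] assms by (auto simp: algebra_simps)
qed

text \<open>The Stieltjes integral of the indicator of \<open>H = 0\<close> recovers \<open>L\<close> on \<open>[0, s]\<close> and on \<open>[0, t]\<close>,
  and the two integrands agree.\<close>

lemma L_eq_if_H_pos:
  assumes "0 \<le> s" "s \<le> t" "\<And>u. s < u \<Longrightarrow> u \<le> t \<Longrightarrow> H u \<noteq> 0"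
  shows "L t = L s"
proof -
  define F where "F = (\<lambda>s. L (max 0 s))"
  let ?M = "interval_measure F"
  have "indicator {0..t} u *\<^sub>R indicator {u. H u = 0} u =
      (indicator {0..s} u *\<^sub>R indicator {u. H u = 0} u :: real)" for u
    using assms(2) assms(3)[of u] by (cases "u \<le> s") (auto simp: indicator_def)
  then have "(LINT u:{0..t}|?M. indicator {u. H u = 0} u :: real) = (LINT u:{0..s}|?M. indicator {u. H u = 0} u)"
    unfolding set_lebesgue_integral_def by presburger
  then show ?thesis using assms L_support_all[rule_format, of s] L_support_all[rule_format, of t] by (simp add: F_def)
qed

text \<open>Without local time, \<open>V + g / \<gamma>\<close> solves \<open>y' = - \<gamma> y\<close>; the local time only pushes it up. As
  \<open>L\<close> need not be differentiable, the proof differentiates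
  \<open>m r = exp (\<gamma> r) (V r + g / \<gamma> + L t - L r)\<close> instead: its derivative \<open>\<gamma> exp (\<gamma> r) (L t - L r)\<close> is
  nonnegative.\<close>

lemma V_decay:
  assumes "0 \<le> s" "s \<le> t"
  shows "exp (- \<gamma> * (t - s)) * (V s + g / \<gamma>) \<le> V t + g / \<gamma>"
    and "L t = L s \<Longrightarrow> V t + g / \<gamma> = exp (- \<gamma> * (t - s)) * (V s + g / \<gamma>)"
proof -
  define m where "m r = exp (\<gamma> * r) * (v - (\<gamma> * integral {0..r} V + g * r) + L t + g / \<gamma>)" for r
  have deriv: "(m has_real_derivative (\<gamma> * exp (\<gamma> * r) * (L t - L r))) (at r)"
    if "s < r" "r < t" for r
  proof -
    have "((\<lambda>r. integral {0..r} V) has_real_derivative V r) (at r within {0..t})"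
      using that assms
      by (intro integral_has_real_derivative continuous_on_subset[OF continuous_on_V]) auto
    then have "((\<lambda>r. integral {0..r} V) has_real_derivative V r) (at r)"
      using that assms by (subst (asm) at_within_Icc_at) auto
    then have "(m has_real_derivative (\<gamma> * exp (\<gamma> * r) *
        (v - (\<gamma> * integral {0..r} V + g * r) + L t + g / \<gamma>) - exp (\<gamma> * r) * (\<gamma> * V r + g))) (at r)"
      unfolding m_def [abs_def] by (auto intro!: derivative_eq_intros simp: algebra_simps)
    moreover have V: "v - (\<gamma> * integral {0..r} V + g * r) = V r - L r"
      using V_eq[of r] that assms by simp
    ultimately show ?thesis
      unfolding V using \<gamma>_pos by (elim DERIV_cong) (simp add: field_simps)
  qed
  have cont: "continuous_on {s..t} m"
    unfolding m_def using assms
    by (intro continuous_intros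
        continuous_on_subset[OF indefinite_integral_continuous_1[of V 0 t]]
        integrable_continuous_real continuous_on_subset[OF continuous_on_V]) auto
  have ms: "m s = exp (\<gamma> * s) * (V s + g / \<gamma> + (L t - L s))"
    and mt: "m t = exp (\<gamma> * t) * (V t + g / \<gamma>)"
    unfolding m_def using V_eq[of s] V_eq[of t] assms by (auto intro!: arg_cong2[where f="(*)"])
  have 1: "m s \<le> m t"
  proof (rule DERIV_nonneg_imp_increasing_open[OF assms(2) _ cont])
    show "\<exists>y. (m has_real_derivative y) (at r) \<and> 0 \<le> y" if "s < r" "r < t" for r
      using deriv[OF that] L_mono[of r t] that assms \<gamma>_pos
      by (intro exI[of _ "\<gamma> * exp (\<gamma> * r) * (L t - L r)"]) auto
  qed
  have e: "exp (- \<gamma> * (t - s)) * x \<le> y \<longleftrightarrow> exp (\<gamma> * s) * x \<le> exp (\<gamma> * t) * y" 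
    "y = exp (- \<gamma> * (t - s)) * x \<longleftrightarrow> exp (\<gamma> * s) * x = exp (\<gamma> * t) * y" for x y
    by (simp_all add: exp_diff exp_minus right_diff_distrib divide_simps mult.commute) (auto simp: mult.commute)
  have "exp (\<gamma> * s) * (V s + g / \<gamma>) \<le> m s"
    using L_mono[OF assms] unfolding ms by (intro mult_left_mono) auto
  then show "exp (- \<gamma> * (t - s)) * (V s + g / \<gamma>) \<le> V t + g / \<gamma>"
    using 1 e mt by simp
  assume Leq: "L t = L s"
  have 2: "m t \<le> m s"
  proof (rule DERIV_nonpos_imp_decreasing_open[OF assms(2) _ cont])
    show "\<exists>y. (m has_real_derivative y) (at r) \<and> y \<le> 0" if "s < r" "r < t" for r
      using deriv[OF that] L_mono[of s r] Leq that assms \<gamma>_pos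
      by (intro exI[of _ "\<gamma> * exp (\<gamma> * r) * (L t - L r)"]) (auto simp: mult_le_0_iff)
  qed
  with 1 show "V t + g / \<gamma> = exp (- \<gamma> * (t - s)) * (V s + g / \<gamma>)"
    using e ms mt Leq by simp
qed

lemma V_minus_H:
  assumes "0 \<le> s" "s \<le> t"
  shows "(V t - H t) - (V s - H s) =
    - integral {s..t} (\<lambda>r. (1 + \<gamma>) * V r + g) + (b t - b s)"
proof -
  have i: "V integrable_on {s..t}" using assms
    by (intro integrable_continuous_real continuous_on_subset[OF continuous_on_V]) auto
  have "integral {s..t} (\<lambda>r. (1 + \<gamma>) * V r + g) = (1 + \<gamma>) * integral {s..t} V + g * (t - s)"
    using assms integrable_on_cmult_left[OF i, of "1 + \<gamma>"] by (subst integral_add) auto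
  then show ?thesis using V_eq_between[OF assms] by (simp add: algebra_simps)
qed

text \<open>Up to time \<open>t\<close> the process either starts an excursion at its last zero \<open>s\<close>, or it has no zero
  and \<open>s = 0\<close>. In both cases the local time does not move on \<open>[s, t]\<close>.\<close>

lemma last_zero:
  assumes "0 \<le> t"
  obtains s where "0 \<le> s" "s \<le> t" "L t = L s" "s = 0 \<or> H s = 0"
proof (cases "\<exists>s\<in>{0..t}. H s = 0")
  case False
  then have "L t = L 0" using assms by (intro L_eq_if_H_pos) auto
  then show ?thesis using that[of 0] assms by simp
next
  case True
  let ?S = "{0..t} \<inter> H -` {0}"
  have "closed ?S"
    by (intro continuous_closed_preimage continuous_on_subset[OF continuous_on_H]) auto
  then have c: "compact ?S" by (metis compact_Icc compact_Int_closed inf_left_idem)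
  have "?S \<noteq> {}" using True by auto
  from compact_attains_sup[OF c this] obtain s where s: "s \<in> ?S" "\<forall>u\<in>?S. u \<le> s" by blast
  have "H u \<noteq> 0" if "s < u" "u \<le> t" for u
    using s that by (auto dest!: bspec[of _ _ u])
  then have "L t = L s" using s by (intro L_eq_if_H_pos) auto
  then show ?thesis using s that[of s] by auto
qed

text \<open>Let \<open>W = V - H + g / (1 + \<gamma>)\<close>. After the last time \<open>r\<close> with \<open>W r \<le> u / 2\<close>, the drift of \<open>W\<close>
  is at most \<open>- (1 + \<gamma>) u / 2\<close>, twice the slope allowed to the noise, so \<open>W\<close> gains at most \<open>u / 2\<close>.
  If there is no such time, the same computation from time \<open>0\<close> gives the second alternative.\<close>

lemma V_minus_H_le:
  assumes u: "0 < u" and st: "0 \<le> \<sigma>"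
    and inc: "\<And>r. 0 \<le> r \<Longrightarrow> r \<le> \<sigma> \<Longrightarrow> b \<sigma> - b r \<le> u / 2 + (1 + \<gamma>) * u / 4 * (\<sigma> - r)"
  shows "V \<sigma> - H \<sigma> + g / (1 + \<gamma>) \<le> u \<or>
    V \<sigma> - H \<sigma> + g / (1 + \<gamma>) \<le> v - h + g / (1 + \<gamma>) + u / 2 - (1 + \<gamma>) * u / 4 * \<sigma>"
proof -
  define W where "W r = V r - H r + g / (1 + \<gamma>)" for r
  have cW: "continuous_on {0..} W"
    unfolding W_def using \<gamma>_pos
    by (intro continuous_intros continuous_on_V continuous_on_H) auto
  have *: "W \<sigma> \<le> W r + u / 2 - (1 + \<gamma>) * u / 4 * (\<sigma> - r)"
    if r: "0 \<le> r" "r \<le> \<sigma>" and above: "\<And>q. r \<le> q \<Longrightarrow> q \<le> \<sigma> \<Longrightarrow> u / 2 \<le> W q" for r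
  proof -
    have "integral {r..\<sigma>} (\<lambda>_. (1 + \<gamma>) * u / 2) \<le> integral {r..\<sigma>} (\<lambda>q. (1 + \<gamma>) * V q + g)"
    proof (rule integral_le)
      show "(\<lambda>q. (1 + \<gamma>) * V q + g) integrable_on {r..\<sigma>}" using r
        by (intro integrable_continuous_real continuous_intros
            continuous_on_subset[OF continuous_on_V]) auto
      have "u / 2 \<le> V q + g / (1 + \<gamma>)" if "q \<in> {r..\<sigma>}" for q
        using above[of q] H_nonneg[of q] r that unfolding W_def by auto
      then have "(1 + \<gamma>) * (u / 2) \<le> (1 + \<gamma>) * (V q + g / (1 + \<gamma>))" if "q \<in> {r..\<sigma>}" for q
        using that \<gamma>_pos by (intro mult_left_mono) auto
      then show "(1 + \<gamma>) * u / 2 \<le> (1 + \<gamma>) * V q + g" if "q \<in> {r..\<sigma>}" for q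
        using that \<gamma>_pos by (simp add: distrib_left[of "1 + \<gamma>"])
    qed auto
    moreover have "integral {r..\<sigma>} (\<lambda>_. (1 + \<gamma>) * u / 2) = 2 * ((1 + \<gamma>) * u / 4 * (\<sigma> - r))"
      using r by (simp add: field_simps)
    ultimately show ?thesis using V_minus_H[OF r] inc[OF r] unfolding W_def by linarith
  qed
  show ?thesis
  proof (cases "\<exists>r\<in>{0..\<sigma>}. W r \<le> u / 2")
    case False
    then have "W \<sigma> \<le> W 0 + u / 2 - (1 + \<gamma>) * u / 4 * (\<sigma> - 0)"
      using st by (intro *) (auto simp: not_le intro: less_imp_le)
    then show ?thesis by (simp add: W_def H_0 V_0 algebra_simps)
  next
    case True
    let ?S = "{0..\<sigma>} \<inter> W -` {..u / 2}"
    have "closed ?S"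
      by (intro continuous_closed_preimage continuous_on_subset[OF cW]) auto
    then have c: "compact ?S" by (metis compact_Icc compact_Int_closed inf_left_idem)
    have "?S \<noteq> {}" using True by auto
    from compact_attains_sup[OF c this]
    obtain r where r: "r \<in> ?S" "\<And>q. q \<in> ?S \<Longrightarrow> q \<le> r" by blast
    show ?thesis
    proof (cases "r = \<sigma>")
      case True
      then have "W \<sigma> \<le> u / 2" using r by simp
      then show ?thesis using u unfolding W_def by linarith
    next
      case False
      with r have r': "0 \<le> r" "r < \<sigma>" "W r \<le> u / 2" by auto
      have gt: "u / 2 \<le> W q" if "q \<in> {r<..\<sigma>}" for q
        using r(2)[of q] r' that by (cases "W q \<le> u / 2") auto
      have "continuous_on (closure {r<..\<sigma>}) W"
        using r' by (auto intro: continuous_on_subset[OF cW])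
      from continuous_ge_on_closure[OF this _ gt]
      have "u / 2 \<le> W q" if "q \<in> {r..\<sigma>}" for q
        using that r' by simp
      then have "W \<sigma> \<le> W r + u / 2 - (1 + \<gamma>) * u / 4 * (\<sigma> - r)"
        using r' by (intro *) auto
      moreover have "0 \<le> (1 + \<gamma>) * u / 4 * (\<sigma> - r)" using \<gamma>_pos u r' by simp
      ultimately show ?thesis using r' by (simp add: W_def)
    qed
  qed
qed

text \<open>Let \<open>s\<close> be the last zero of \<open>H\<close>. If \<open>s \<ge> T / 2\<close>, the drift has had time to bring \<open>V\<close> below the
  level by time \<open>s\<close>, where \<open>V = V - H\<close>; if \<open>s < T / 2\<close>, then \<open>V + g / \<gamma>\<close> shrinks by the
  factor \<open>5\<close> on \<open>[s, T]\<close>.\<close>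

lemma V_le_level:
  assumes u: "0 < u" and T: "12 \<le> (1 + \<gamma>) * T" "exp (- \<gamma> * T / 2) \<le> 1 / 5"
    and inc: "\<And>r s. 0 \<le> r \<Longrightarrow> r \<le> s \<Longrightarrow> s \<le> T \<Longrightarrow>
      b s - b r \<le> u / 2 + (1 + \<gamma>) * u / 4 * (s - r)"
    and v: "v + g / (1 + \<gamma>) \<le> 2 * u"
  shows "V T + g / (1 + \<gamma>) \<le> u"
proof -
  have "0 < (1 + \<gamma>) * T" using T(1) by linarith
  then have Tpos: "0 < T" by (rule zero_less_mult_pos) (use \<gamma>_pos in linarith)
  have "g / (1 + \<gamma>) \<le> g / \<gamma>"
    by (rule divide_left_mono) (use \<gamma>_pos g_pos in simp_all)
  moreover have "x + p \<le> u"
    if "p \<le> q" "x + q \<le> 1 / 5 * (y + q)" "y + p \<le> 5 / 2 * u" for x y p q :: real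
    using u that by argo
  ultimately have arith: "x + g / (1 + \<gamma>) \<le> u"
    if "x + g / \<gamma> \<le> 1 / 5 * (y + g / \<gamma>)" "y + g / (1 + \<gamma>) \<le> 5 / 2 * u" for x y
    using that by blast
  obtain s where s: "0 \<le> s" "s \<le> T" "L T = L s" "s = 0 \<or> H s = 0"
    using last_zero[OF less_imp_le[OF Tpos]] .
  have VT: "V T + g / \<gamma> = exp (- \<gamma> * (T - s)) * (V s + g / \<gamma>)"
    by (rule V_decay(2)[OF s(1-3)])
  have pos: "0 \<le> V s + g / \<gamma>" using V_gt[of s] s by simp
  have h: "0 \<le> h" using H_nonneg[of 0] H_0 by simp
  have Vs: "V s + g / (1 + \<gamma>) \<le> u \<or> V s + g / (1 + \<gamma>) \<le> 5 / 2 * u - (1 + \<gamma>) * u / 4 * s"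
  proof (cases "s = 0")
    case True
    then have "V s = v" "(1 + \<gamma>) * u / 4 * s = 0" using V_0 by simp_all
    then show ?thesis using v u by argo
  next
    case False
    then have "H s = 0" using s by simp
    moreover have "V s - H s + g / (1 + \<gamma>) \<le> u \<or>
      V s - H s + g / (1 + \<gamma>) \<le> v - h + g / (1 + \<gamma>) + u / 2 - (1 + \<gamma>) * u / 4 * s"
      by (rule V_minus_H_le[OF u s(1)]) (use inc s in simp)
    ultimately show ?thesis using v h by argo
  qed
  show ?thesis
  proof (cases "s < T / 2")
    case True
    have "0 \<le> (1 + \<gamma>) * u / 4 * s" using \<gamma>_pos u s by simp
    with Vs u have Vs': "V s + g / (1 + \<gamma>) \<le> 5 / 2 * u" by linarith
    have "\<gamma> * (T / 2) \<le> \<gamma> * (T - s)" using True \<gamma>_pos by (intro mult_left_mono) auto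
    then have "exp (- \<gamma> * (T - s)) \<le> exp (- \<gamma> * T / 2)" by simp
    also note T(2)
    finally have "V T + g / \<gamma> \<le> 1 / 5 * (V s + g / \<gamma>)"
      unfolding VT using pos by (rule mult_right_mono)
    then show ?thesis using Vs' by (rule arith)
  next
    case False
    have "(1 + \<gamma>) * T \<le> (1 + \<gamma>) * (2 * s)"
      using False \<gamma>_pos by (intro mult_left_mono) auto
    with T(1) have "12 \<le> (1 + \<gamma>) * (2 * s)" by linarith
    then have "12 * u \<le> (1 + \<gamma>) * (2 * s) * u" using u by (intro mult_right_mono) auto
    moreover have "(1 + \<gamma>) * (2 * s) * u = 8 * ((1 + \<gamma>) * u / 4 * s)" by simp
    ultimately have Vs': "V s + g / (1 + \<gamma>) \<le> u" using Vs by linarith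
    have "V T + g / \<gamma> \<le> 1 * (V s + g / \<gamma>)"
      unfolding VT using s \<gamma>_pos by (intro mult_right_mono pos) simp
    then have "V T \<le> V s" by simp
    then show ?thesis using Vs' by linarith
  qed
qed

text \<open>On \<open>[s, T]\<close>, where \<open>s\<close> is the last zero of \<open>H\<close>, the process \<open>H + V / \<gamma>\<close> has drift \<open>- g / \<gamma>\<close>. Half of
  this drift absorbs the noise; the other half, over the full time \<open>T\<close>, amounts to \<open>2 x\<close> and
  consumes the starting height when there is no zero.\<close>

lemma H_le_level:
  assumes x: "0 < x" "4 * g / \<gamma>\<^sup>2 \<le> x" and T: "T = 4 * \<gamma> * x / g" and u: "u = \<gamma> * x / 6"
    and inc: "\<And>r s. 0 \<le> r \<Longrightarrow> r \<le> s \<Longrightarrow> s \<le> T \<Longrightarrow>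
      b s - b r \<le> u / 2 + (1 + \<gamma>) * u / 4 * (s - r)"
    and dec: "\<And>s. 0 \<le> s \<Longrightarrow> s \<le> T \<Longrightarrow> - (b T - b s) \<le> x / 4 + g / (2 * \<gamma>) * (T - s)"
    and v: "v + g / (1 + \<gamma>) \<le> u" and h: "h \<le> 2 * x"
  shows "H T \<le> x"
proof -
  have Tpos: "0 < T" and upos: "0 < u" unfolding T u using x \<gamma>_pos g_pos by auto
  have gg: "0 \<le> g / (1 + \<gamma>)" "g / \<gamma> / \<gamma> \<le> x / 4"
    using \<gamma>_pos g_pos x(2) by (simp_all add: power2_eq_square mult.commute)
  obtain s where s: "0 \<le> s" "s \<le> T" "L T = L s" "s = 0 \<or> H s = 0"
    using last_zero[OF less_imp_le[OF Tpos]] .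
  have "\<gamma> * integral {s..T} V = V s - V T - g * (T - s)"
    using V_eq_between(1)[of s T] s by simp
  then have "integral {s..T} V = (V s - V T - g * (T - s)) / \<gamma>"
    using \<gamma>_pos by (simp add: nonzero_eq_divide_eq mult.commute)
  then have "integral {s..T} V = (V s - V T) / \<gamma> - g / \<gamma> * (T - s)"
    by (simp add: diff_divide_distrib)
  moreover have "(V s - V T) / \<gamma> \<le> (V s + g / \<gamma>) / \<gamma>"
    using V_gt[of T] Tpos \<gamma>_pos by (intro divide_right_mono) auto
  moreover have "g / \<gamma> * (T - s) = 2 * (g / (2 * \<gamma>) * (T - s))" by simp
  ultimately have HT: "H T \<le> H s + V s / \<gamma> + x / 2 - g / (2 * \<gamma>) * (T - s)"
    using V_eq_between(2)[of s T] dec[of s] s gg(2) add_divide_distrib[of "V s" "g / \<gamma>" \<gamma>] by linarith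
  show ?thesis
  proof (cases "H s = 0")
    case False
    then have "s = 0" using s by simp
    have "g / (2 * \<gamma>) * T = 2 * x" using T g_pos \<gamma>_pos by simp
    moreover have "v / \<gamma> \<le> u / \<gamma>" using v gg \<gamma>_pos by (intro divide_right_mono) auto
    moreover have "u / \<gamma> = x / 6" unfolding u using \<gamma>_pos by simp
    moreover have "H T \<le> h + v / \<gamma> + x / 2 - g / (2 * \<gamma>) * T"
      using HT \<open>s = 0\<close> V_0 H_0 by simp
    ultimately show ?thesis using h x by linarith
  next
    case True
    have h: "0 \<le> h" using H_nonneg[of 0] H_0 by simp
    have nonneg: "0 \<le> (1 + \<gamma>) * u / 4 * s" "0 \<le> g / (2 * \<gamma>) * (T - s)"
      using \<gamma>_pos g_pos upos s by auto
    have "V s - H s + g / (1 + \<gamma>) \<le> u \<or>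
      V s - H s + g / (1 + \<gamma>) \<le> v - h + g / (1 + \<gamma>) + u / 2 - (1 + \<gamma>) * u / 4 * s"
      by (rule V_minus_H_le[OF upos s(1)]) (use inc s in simp)
    then have "V s \<le> 3 / 2 * u" using v h True gg(1) upos nonneg(1) by argo
    then have "V s / \<gamma> \<le> 3 / 2 * u / \<gamma>" using \<gamma>_pos by (intro divide_right_mono) auto
    moreover have "3 / 2 * u / \<gamma> = x / 4" unfolding u using \<gamma>_pos by simp
    ultimately show ?thesis using HT x True nonneg(2) by linarith
  qed
qed

lemma H_ge:
  assumes "0 \<le> T" shows "- (g / \<gamma>) * T - (b T - b 0) \<le> H T"
proof -
  have "integral {0..T} (\<lambda>_. - (g / \<gamma>)) \<le> integral {0..T} V"
    using V_gt[THEN less_imp_le]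
    by (intro integral_le integrable_continuous_real continuous_on_subset[OF continuous_on_V]) auto
  then show ?thesis
    using V_eq_between(2)[OF order_refl assms] L_mono[OF order_refl assms] H_nonneg[OF order_refl] assms
    by (simp add: mult.commute)
qed

text \<open>Argue by contradiction: by \<open>V_decay\<close>, a value \<open>V T \<le> y\<close> bounds \<open>V s + g / \<gamma>\<close> by
  \<open>exp (\<gamma> (T - s)) (y + g / \<gamma>)\<close> for all earlier \<open>s\<close>, hence bounds the integrated drift of \<open>V - H\<close>.\<close>

lemma V_gt_level:
  assumes "0 \<le> T" and h: "h \<le> R"
    and inc: "y + R + g / \<gamma> + (1 + \<gamma>) * ((exp (\<gamma> * T) - 1) / \<gamma>) * (y + g / \<gamma>) < b T - b 0"
  shows "y < V T"
proof (rule ccontr)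
  assume "\<not> y < V T"
  then have y: "V T \<le> y" by simp
  let ?q = "y + g / \<gamma>"
  have Vs: "(1 + \<gamma>) * V s + g \<le> (1 + \<gamma>) * (exp (\<gamma> * (T - s)) * ?q)" if "s \<in> {0..T}" for s
  proof -
    have "exp (\<gamma> * (T - s)) * (exp (- \<gamma> * (T - s)) * (V s + g / \<gamma>)) \<le> exp (\<gamma> * (T - s)) * (V T + g / \<gamma>)"
      using V_decay(1)[of s T] that by (intro mult_left_mono) auto
    also have "exp (\<gamma> * (T - s)) * (exp (- \<gamma> * (T - s)) * (V s + g / \<gamma>)) = V s + g / \<gamma>"
      by (simp flip: exp_add mult.assoc)
    also have "exp (\<gamma> * (T - s)) * (V T + g / \<gamma>) \<le> exp (\<gamma> * (T - s)) * ?q" using y by simp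
    finally have "(1 + \<gamma>) * (V s + g / \<gamma>) \<le> (1 + \<gamma>) * (exp (\<gamma> * (T - s)) * ?q)"
      using \<gamma>_pos by (intro mult_left_mono) auto
    moreover have "(1 + \<gamma>) * (V s + g / \<gamma>) = (1 + \<gamma>) * V s + g + g / \<gamma>"
      using \<gamma>_pos by (simp add: field_simps)
    moreover have "0 < g / \<gamma>" using \<gamma>_pos g_pos by simp
    ultimately show ?thesis by linarith
  qed
  have "((\<lambda>s. (1 + \<gamma>) * (exp (\<gamma> * (T - s)) * ?q)) has_integral
      (1 + \<gamma>) * (- exp (\<gamma> * (T - T)) / \<gamma> * ?q) - (1 + \<gamma>) * (- exp (\<gamma> * (T - 0)) / \<gamma> * ?q)) {0..T}"
    using \<gamma>_pos assms(1) by (intro fundamental_theorem_of_calculus)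
      (auto intro!: derivative_eq_intros simp flip: has_real_derivative_iff_has_vector_derivative)
  moreover have "(1 + \<gamma>) * (- exp (\<gamma> * (T - T)) / \<gamma> * ?q) - (1 + \<gamma>) * (- exp (\<gamma> * (T - 0)) / \<gamma> * ?q)
      = (1 + \<gamma>) * ((exp (\<gamma> * T) - 1) / \<gamma>) * ?q"
    using \<gamma>_pos by (simp add: field_simps)
  ultimately have I: "((\<lambda>s. (1 + \<gamma>) * (exp (\<gamma> * (T - s)) * ?q)) has_integral
    (1 + \<gamma>) * ((exp (\<gamma> * T) - 1) / \<gamma>) * ?q) {0..T}" by metis
  have "integral {0..T} (\<lambda>s. (1 + \<gamma>) * V s + g) \<le> (1 + \<gamma>) * ((exp (\<gamma> * T) - 1) / \<gamma>) * ?q"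
    unfolding integral_unique[OF I, symmetric] using Vs I
    by (intro integral_le integrable_continuous_real continuous_intros
        continuous_on_subset[OF continuous_on_V]) auto
  then have "y < V T - H T"
    using V_minus_H[of 0 T] assms V_gt[of 0] V_0 H_0 by simp
  then show False using y H_nonneg[OF assms(1)] by simp
qed

end

section \<open>Extremal increments of Brownian motion\<close>

lemma (in prob_space) nn_integral_mult_indep:
  fixes U W :: "'a \<Rightarrow> real"
  assumes "indep_var borel U borel W" "\<And>\<omega>. 0 \<le> U \<omega>" "\<And>\<omega>. 0 \<le> W \<omega>"
  shows "(\<integral>\<^sup>+\<omega>. ennreal (U \<omega> * W \<omega>) \<partial>M) = (\<integral>\<^sup>+\<omega>. U \<omega> \<partial>M) * (\<integral>\<^sup>+\<omega>. W \<omega> \<partial>M)"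
proof -
  have eq: "case_bool borel borel = (\<lambda>_. borel :: real measure)"
    by (auto split: bool.split)
  have ind: "indep_vars (\<lambda>_. borel) (case_bool U W) UNIV"
    using assms(1) unfolding indep_var_def eq .
  have ind': "indep_vars (\<lambda>_. borel) (\<lambda>i \<omega>. ennreal (case_bool U W i \<omega>)) UNIV"
    by (rule indep_vars_compose2[OF ind]) auto
  show ?thesis
    using indep_vars_nn_integral[OF finite ind'] assms(2,3)
    by (simp add: UNIV_bool ennreal_mult mult.commute)
qed

text \<open>Doob's inequality for the supermartingale \<open>exp (S k)\<close>, where \<open>S k\<close> are the partial sums. The
  proof stops the sums when they first exceed \<open>A\<close>: the stopped variable \<open>Y k\<close> has expectation at
  most \<open>1\<close>, because the next increment is independent of the event of not having stopped, and
  \<open>Y n\<close> exceeds \<open>exp A\<close> on the event in question.\<close>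

lemma (in prob_space) maximal_inequality_exp_sums:
  fixes X :: "nat \<Rightarrow> 'a \<Rightarrow> real"
  assumes ind: "indep_vars (\<lambda>_. borel) X {..<n}"
    and le1: "\<And>i. i < n \<Longrightarrow> (\<integral>\<^sup>+\<omega>. ennreal (exp (X i \<omega>)) \<partial>M) \<le> 1"
  shows "emeasure M {\<omega> \<in> space M. \<exists>k\<le>n. A < (\<Sum>i<k. X i \<omega>)} \<le> ennreal (exp (- A))"
proof -
  have X[measurable]: "X i \<in> borel_measurable M" if "i < n" for i
    using ind that by (auto simp: indep_vars_def)
  define S where "S k \<omega> = (\<Sum>i<k. X i \<omega>)" for k \<omega>
  define below where "below k \<omega> \<longleftrightarrow> (\<forall>j\<le>k. S j \<omega> \<le> A)" for k \<omega>
  define Y where "Y = rec_nat (\<lambda>_. 1) (\<lambda>k y \<omega>. if below k \<omega> then exp (S (Suc k) \<omega>) else y \<omega>)"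
  have Y0: "Y 0 \<omega> = 1" and YSuc: "Y (Suc k) \<omega> = (if below k \<omega> then exp (S (Suc k) \<omega>) else Y k \<omega>)" for k \<omega>
    by (simp_all add: Y_def)
  have S[measurable]: "S k \<in> borel_measurable M" if "k \<le> n" for k
    unfolding S_def using that by (intro borel_measurable_sum X) auto
  have below[measurable]: "Measurable.pred M (below k)" if "k \<le> n" for k
  proof -
    have "Measurable.pred M (\<lambda>\<omega>. \<forall>j\<in>{..k}. S j \<omega> \<le> A)"
    proof (rule pred_intros_finite(3))
      fix j assume "j \<in> {..k}"
      then have [measurable]: "S j \<in> borel_measurable M" using that by (intro S) simp
      show "Measurable.pred M (\<lambda>\<omega>. S j \<omega> \<le> A)" by measurable
    qed simp
    then show ?thesis by (simp only: below_def[abs_def] Ball_def atMost_iff)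
  qed
  have Y[measurable]: "Y k \<in> borel_measurable M" if "k \<le> n" for k
    using that
  proof (induction k)
    case (Suc k)
    from Suc.prems have k: "k \<le> n" "Suc k \<le> n" by simp_all
    note [measurable] = Suc.IH[OF k(1)] below[OF k(1)] S[OF k(2)]
    show ?case unfolding YSuc[abs_def] by measurable
  qed (simp add: Y0[abs_def])
  have Y_nonneg: "0 \<le> Y k \<omega>" for k \<omega>
    by (induction k) (auto simp: Y0 YSuc)
  have Y_below: "Y k \<omega> = exp (S k \<omega>)" if "below k \<omega>" for k \<omega>
    using that by (cases k) (auto simp: Y0 YSuc below_def S_def)
  have Y_above: "exp A < Y k \<omega>" if "\<not> below k \<omega>" for k \<omega>
    using that
  proof (induction k)
    case 0 then show ?case by (auto simp: below_def S_def Y0)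
  next
    case (Suc k)
    show ?case
    proof (cases "below k \<omega>")
      case True
      then have "A < S (Suc k) \<omega>"
        using Suc.prems unfolding below_def by (metis le_Suc_eq not_le)
      then show ?thesis using True by (simp add: YSuc)
    next
      case False
      then show ?thesis using Suc.IH by (simp add: YSuc)
    qed
  qed
  have Y_le: "(\<integral>\<^sup>+\<omega>. Y k \<omega> \<partial>M) \<le> 1" if "k \<le> n" for k
    using that
  proof (induction k)
    case 0 then show ?case by (simp add: Y0 emeasure_space_1)
  next
    case (Suc k)
    then have k: "k < n" "k \<le> n" by auto
    define U where "U \<omega> = (if below k \<omega> then exp (S k \<omega>) else 0)" for \<omega>
    \<comment> \<open>\<open>U\<close> as a function of the first \<open>k\<close> summands, which makes it independent of \<open>X k\<close>.\<close>
    define f where "f x = (if \<forall>j\<le>k. (\<Sum>i<j. x i) \<le> A then exp (\<Sum>i<k. x i) else 0)" for x :: "nat \<Rightarrow> real"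
    have [measurable]: "(\<lambda>x. x i) \<in> borel_measurable (PiM {..<k} (\<lambda>_. borel :: real measure))" if "i < k" for i
      using that by simp
    have sum[measurable]: "(\<lambda>x. \<Sum>i<j. x i) \<in> borel_measurable (PiM {..<k} (\<lambda>_. borel :: real measure))" if "j \<le> k" for j
      using that by (intro borel_measurable_sum) auto
    have "Measurable.pred (PiM {..<k} (\<lambda>_. borel)) (\<lambda>x. \<forall>j\<in>{..k}. (\<Sum>i<j. x i) \<le> A)"
    proof (rule pred_intros_finite(3))
      fix j assume "j \<in> {..k}"
      then have [measurable]: "(\<lambda>x. \<Sum>i<j. x i) \<in> borel_measurable (PiM {..<k} (\<lambda>_. borel :: real measure))"
        by (intro sum) simp
      show "Measurable.pred (PiM {..<k} (\<lambda>_. borel)) (\<lambda>x. (\<Sum>i<j. x i) \<le> A)" by measurable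
    qed simp
    then have [measurable]: "Measurable.pred (PiM {..<k} (\<lambda>_. borel)) (\<lambda>x. \<forall>j\<le>k. (\<Sum>i<j. x i) \<le> A)"
      by (simp only: Ball_def atMost_iff)
    have [measurable]: "f \<in> borel_measurable (PiM {..<k} (\<lambda>_. borel))"
      unfolding f_def using sum[of k] by measurable
    have "indep_var borel (f \<circ> (\<lambda>\<omega>. restrict (\<lambda>i. X i \<omega>) {..<k}))
        borel ((\<lambda>x. exp (x k)) \<circ> (\<lambda>\<omega>. restrict (\<lambda>i. X i \<omega>) {k}))"
      using k by (intro indep_var_compose[OF indep_var_restrict[OF ind]]) auto
    moreover have "f \<circ> (\<lambda>\<omega>. restrict (\<lambda>i. X i \<omega>) {..<k}) = U"
      by (auto simp: f_def U_def S_def below_def fun_eq_iff)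
    moreover have "(\<lambda>x. exp (x k)) \<circ> (\<lambda>\<omega>. restrict (\<lambda>i. X i \<omega>) {k}) = (\<lambda>\<omega>. exp (X k \<omega>))"
      by auto
    ultimately have indep: "indep_var borel U borel (\<lambda>\<omega>. exp (X k \<omega>))" by simp
    have U_nonneg: "0 \<le> U \<omega>" for \<omega> by (simp add: U_def)
    have [measurable]: "X k \<in> borel_measurable M" "Measurable.pred M (below k)"
      "S k \<in> borel_measurable M" "Y k \<in> borel_measurable M" using k by (auto intro: X below S Y)
    have [measurable]: "U \<in> borel_measurable M" unfolding U_def by measurable
    let ?R = "\<lambda>\<omega>. if below k \<omega> then 0 else Y k \<omega>"
    have "(\<integral>\<^sup>+\<omega>. Y (Suc k) \<omega> \<partial>M) = (\<integral>\<^sup>+\<omega>. ennreal (U \<omega> * exp (X k \<omega>)) + ennreal (?R \<omega>) \<partial>M)"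
      by (intro nn_integral_cong) (auto simp: YSuc U_def S_def exp_add)
    also have "\<dots> = (\<integral>\<^sup>+\<omega>. ennreal (U \<omega> * exp (X k \<omega>)) \<partial>M) + (\<integral>\<^sup>+\<omega>. ?R \<omega> \<partial>M)"
      by (rule nn_integral_add) measurable
    also have "(\<integral>\<^sup>+\<omega>. ennreal (U \<omega> * exp (X k \<omega>)) \<partial>M) = (\<integral>\<^sup>+\<omega>. U \<omega> \<partial>M) * (\<integral>\<^sup>+\<omega>. exp (X k \<omega>) \<partial>M)"
      by (rule nn_integral_mult_indep[OF indep U_nonneg]) simp
    also have "\<dots> \<le> (\<integral>\<^sup>+\<omega>. U \<omega> \<partial>M) * 1"
      by (intro mult_left_mono le1 k) simp
    also have "(\<integral>\<^sup>+\<omega>. U \<omega> \<partial>M) * 1 + (\<integral>\<^sup>+\<omega>. ?R \<omega> \<partial>M) = (\<integral>\<^sup>+\<omega>. ennreal (U \<omega>) + ennreal (?R \<omega>) \<partial>M)"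
      by (subst nn_integral_add) auto
    also have "\<dots> = (\<integral>\<^sup>+\<omega>. Y k \<omega> \<partial>M)"
      by (intro nn_integral_cong) (auto simp: U_def Y_below)
    finally show ?case using Suc by (simp add: add_right_mono)
  qed
  have "{\<omega> \<in> space M. \<exists>k\<le>n. A < (\<Sum>i<k. X i \<omega>)} = {\<omega> \<in> space M. \<not> below n \<omega>}"
    by (auto simp: below_def S_def not_le)
  then have "emeasure M {\<omega> \<in> space M. \<exists>k\<le>n. A < (\<Sum>i<k. X i \<omega>)} =
      emeasure M {\<omega> \<in> space M. \<not> below n \<omega>}" by (rule arg_cong)
  also have "\<dots> = (\<integral>\<^sup>+\<omega>. indicator {\<omega> \<in> space M. \<not> below n \<omega>} \<omega> \<partial>M)"
    using below[of n] by simp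
  also have "\<dots> \<le> (\<integral>\<^sup>+\<omega>. ennreal (exp (- A)) * Y n \<omega> \<partial>M)"
  proof (rule nn_integral_mono)
    fix \<omega>
    have "1 \<le> exp (- A) * Y n \<omega>" if "\<not> below n \<omega>"
      using mult_left_mono[OF less_imp_le[OF Y_above[OF that]], of "exp (- A)"]
      by (simp add: exp_minus)
    then show "indicator {\<omega> \<in> space M. \<not> below n \<omega>} \<omega> \<le> ennreal (exp (- A)) * Y n \<omega>"
      by (auto simp: indicator_def simp flip: ennreal_mult' ennreal_1 intro!: ennreal_leI)
  qed
  also have "\<dots> = ennreal (exp (- A)) * (\<integral>\<^sup>+\<omega>. Y n \<omega> \<partial>M)"
    by (rule nn_integral_cmult) (use Y[of n] in simp)
  also have "\<dots> \<le> ennreal (exp (- A)) * 1" by (intro mult_left_mono Y_le) auto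
  finally show ?thesis by simp
qed

context brownian_motion
begin

lemma exp_increment:
  assumes "0 \<le> s" "s < t"
  shows "(\<integral>\<^sup>+\<omega>. ennreal (exp (c * (B t \<omega> - B s \<omega>) - c\<^sup>2 * (t - s) / 2)) \<partial>M) = 1"
proof -
  define \<sigma> where "\<sigma> = sqrt (t - s)"
  have \<sigma>: "0 < \<sigma>" "t - s = \<sigma>\<^sup>2" using assms by (auto simp: \<sigma>_def)
  have "(\<integral>\<^sup>+\<omega>. ennreal (exp (c * (B t \<omega> - B s \<omega>) - c\<^sup>2 * (t - s) / 2)) \<partial>M) =
    (\<integral>\<^sup>+x. ennreal (normal_density 0 \<sigma> x) * ennreal (exp (c * x - c\<^sup>2 * (t - s) / 2)) \<partial>lborel)"
    using distributed_nn_integral[OF normal_increments[OF assms],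
        of "\<lambda>x. ennreal (exp (c * x - c\<^sup>2 * (t - s) / 2))"] by (simp add: \<sigma>_def)
  also have "\<dots> = (\<integral>\<^sup>+x. ennreal (normal_density (c * \<sigma>\<^sup>2) \<sigma> x) \<partial>lborel)"
  proof (intro nn_integral_cong)
    fix x :: real
    have "- (x - 0)\<^sup>2 / (2 * \<sigma>\<^sup>2) + (c * x - c\<^sup>2 * \<sigma>\<^sup>2 / 2) = - (x - c * \<sigma>\<^sup>2)\<^sup>2 / (2 * \<sigma>\<^sup>2)"
      using \<sigma>(1) by (simp add: field_simps power2_eq_square)
    then show "ennreal (normal_density 0 \<sigma> x) * ennreal (exp (c * x - c\<^sup>2 * (t - s) / 2)) =
        ennreal (normal_density (c * \<sigma>\<^sup>2) \<sigma> x)"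
      unfolding \<sigma>(2) normal_density_def
      by (simp add: mult.assoc flip: ennreal_mult exp_add)
  qed
  also have "\<dots> = 1"
    using \<sigma>(1) by (subst nn_integral_eq_integral) auto
  finally show ?thesis .
qed

text \<open>The discrete inequality applies to the increments along each dyadic grid of \<open>[r, r + T]\<close>. The
  exceptional events increase with the grid, so the bound survives in the limit, and continuity of the
  paths extends it from dyadic to all times.\<close>

lemma maximal_inequality:
  assumes r: "0 \<le> r" and T: "0 < T"
  shows "\<exists>N\<in>events. prob N \<le> exp (- A) \<and>
    (AE \<omega> in M. \<omega> \<notin> N \<longrightarrow> (\<forall>s\<in>{0..T}. c * (B (r + s) \<omega> - B r \<omega>) - c\<^sup>2 * s / 2 \<le> A))"
proof -
  define \<tau> where "\<tau> m i = r + T * real i / 2 ^ m" for m i :: nat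
  have \<tau>: "0 \<le> \<tau> m i" "\<tau> m 0 = r" for m i using r T by (auto simp: \<tau>_def)
  have \<tau>_mono: "\<tau> m i < \<tau> m j \<longleftrightarrow> i < j" for m i j using T by (simp add: \<tau>_def field_simps)
  define P where "P m k \<omega> \<longleftrightarrow> A < c * (B (\<tau> m k) \<omega> - B r \<omega>) - c\<^sup>2 * (\<tau> m k - r) / 2" for m k \<omega>
  define E where "E m = {\<omega> \<in> space M. \<exists>k\<le>2 ^ m. P m k \<omega>}" for m :: nat
  have [measurable]: "B (\<tau> m k) \<in> borel_measurable M" "B r \<in> borel_measurable M" for m k
    using \<tau> r by (auto intro: measurable_B)
  have [measurable]: "E m \<in> events" for m
    unfolding E_def P_def by measurable
  have E_le: "emeasure M (E m) \<le> exp (- A)" for m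
  proof -
    define X where "X i \<omega> = c * (B (\<tau> m (Suc i)) \<omega> - B (\<tau> m i) \<omega>) - c\<^sup>2 * (\<tau> m (Suc i) - \<tau> m i) / 2" for i \<omega>
    have "indep_vars (\<lambda>_. borel) (\<lambda>i \<omega>. B (\<tau> m (Suc i)) \<omega> - B (\<tau> m i) \<omega>) {..<2 ^ m}"
      by (rule indep_increments) (auto simp: \<tau>(1) strict_mono_on_def \<tau>_mono)
    then have "indep_vars (\<lambda>_. borel) X {..<2 ^ m}"
      unfolding X_def[abs_def]
      by (rule indep_vars_compose2[where Y="\<lambda>i x. c * x - c\<^sup>2 * (\<tau> m (Suc i) - \<tau> m i) / 2"]) auto
    moreover have "(\<integral>\<^sup>+\<omega>. ennreal (exp (X i \<omega>)) \<partial>M) \<le> 1" for i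
      unfolding X_def using \<tau> \<tau>_mono by (subst exp_increment) auto
    ultimately have "emeasure M {\<omega> \<in> space M. \<exists>k\<le>2 ^ m. A < (\<Sum>i<k. X i \<omega>)} \<le> exp (- A)"
      by (rule maximal_inequality_exp_sums)
    moreover have "(\<Sum>i<k. X i \<omega>) = c * (B (\<tau> m k) \<omega> - B r \<omega>) - c\<^sup>2 * (\<tau> m k - r) / 2" for k \<omega>
      unfolding X_def by (induction k) (simp_all add: \<tau> algebra_simps add_divide_distrib diff_divide_distrib)
    ultimately show ?thesis by (simp add: E_def P_def)
  qed
  have inc: "incseq E"
  proof (intro incseq_SucI subsetI)
    fix m \<omega> assume "\<omega> \<in> E m"
    then obtain k where "\<omega> \<in> space M" "k \<le> 2 ^ m" "P m k \<omega>" by (auto simp: E_def)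
    moreover have "\<tau> (Suc m) (2 * k) = \<tau> m k" by (simp add: \<tau>_def)
    ultimately show "\<omega> \<in> E (Suc m)" by (auto simp: E_def P_def intro!: exI[of _ "2 * k"])
  qed
  let ?N = "\<Union>m. E m"
  have "emeasure M ?N = (SUP m. emeasure M (E m))"
    using inc by (subst SUP_emeasure_incseq) auto
  also have "\<dots> \<le> exp (- A)" by (intro SUP_least E_le)
  finally have "prob ?N \<le> exp (- A)" by (simp add: emeasure_eq_measure)
  moreover have "AE \<omega> in M. \<omega> \<notin> ?N \<longrightarrow>
    (\<forall>s\<in>{0..T}. c * (B (r + s) \<omega> - B r \<omega>) - c\<^sup>2 * s / 2 \<le> A)"
    using AE_continuous AE_space
  proof eventually_elim
    case (elim \<omega>)
    show ?case
    proof (intro impI ballI)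
      fix s assume N: "\<omega> \<notin> ?N" and s: "s \<in> {0..T}"
      \<comment> \<open>\<open>\<tau> m (k m)\<close> is the grid point just below \<open>r + s\<close>.\<close>
      define k where "k m = nat \<lfloor>s / T * 2 ^ m\<rfloor>" for m :: nat
      have k: "real (k m) \<le> s / T * 2 ^ m" "s / T * 2 ^ m - 1 \<le> real (k m)" for m
        using s T unfolding k_def by (auto simp: of_nat_nat)
      have "s / T * 2 ^ m \<le> 1 * 2 ^ m" for m :: nat using s T by (intro mult_right_mono) auto
      then have "real (k m) \<le> real (2 ^ m)" for m
        using order_trans[OF k(1)[of m], of "2 ^ m"] by simp
      then have k2: "k m \<le> 2 ^ m" for m using of_nat_le_iff by blast
      have up: "\<tau> m (k m) \<le> r + s" and lo: "r + s - T * (1 / 2) ^ m \<le> \<tau> m (k m)" for m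
      proof -
        have eq: "T / 2 ^ m * (s / T * 2 ^ m) = s" "T / 2 ^ m * (s / T * 2 ^ m - 1) = s - T * (1 / 2) ^ m"
          "T / 2 ^ m * real (k m) = T * real (k m) / 2 ^ m"
          using T by (simp_all add: right_diff_distrib power_one_over)
        have pos: "0 \<le> T / 2 ^ m" using T by simp
        from mult_left_mono[OF k(1)[of m] pos] mult_left_mono[OF k(2)[of m] pos]
        show "\<tau> m (k m) \<le> r + s" "r + s - T * (1 / 2) ^ m \<le> \<tau> m (k m)"
          unfolding eq \<tau>_def by linarith+
      qed
      have "(\<lambda>m. r + s - T * (1 / 2) ^ m) \<longlonglongrightarrow> r + s - T * 0"
        by (intro tendsto_intros LIMSEQ_power_zero) auto
      then have lim0: "(\<lambda>m. r + s - T * (1 / 2) ^ m) \<longlonglongrightarrow> r + s" by simp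
      have ev1: "\<forall>\<^sub>F m in sequentially. r + s - T * (1 / 2) ^ m \<le> \<tau> m (k m)"
        by (intro always_eventually allI lo)
      have ev2: "\<forall>\<^sub>F m in sequentially. \<tau> m (k m) \<le> r + s"
        by (intro always_eventually allI up)
      have lim: "(\<lambda>m. \<tau> m (k m)) \<longlonglongrightarrow> r + s"
        by (rule tendsto_sandwich[OF ev1 ev2 lim0 tendsto_const])
      have "r + s \<in> {0..}" "\<forall>\<^sub>F m in sequentially. \<tau> m (k m) \<in> {0..}"
        using r s \<tau>(1) by auto
      note limB = continuous_on_tendsto_compose[OF elim(1) lim this]
      have lim_le: "(\<lambda>m. c * (B (\<tau> m (k m)) \<omega> - B r \<omega>) - c\<^sup>2 * (\<tau> m (k m) - r) / 2) \<longlonglongrightarrow>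
          c * (B (r + s) \<omega> - B r \<omega>) - c\<^sup>2 * (r + s - r) / 2"
        by (intro tendsto_intros lim limB) simp
      have "\<not> P m (k m) \<omega>" for m using N k2[of m] elim(2) unfolding E_def by blast
      then have "\<exists>m0. \<forall>m\<ge>m0. c * (B (\<tau> m (k m)) \<omega> - B r \<omega>) - c\<^sup>2 * (\<tau> m (k m) - r) / 2 \<le> A"
        unfolding P_def not_less by blast
      from LIMSEQ_le_const2[OF lim_le this]
      have "c * (B (r + s) \<omega> - B r \<omega>) - c\<^sup>2 * (r + s - r) / 2 \<le> A" .
      then show "c * (B (r + s) \<omega> - B r \<omega>) - c\<^sup>2 * s / 2 \<le> A" by simp
    qed
  qed
  ultimately show ?thesis by (intro bexI[of _ ?N]) auto
qed

text \<open>A single \<open>c (B s - B r)\<close> exceeds \<open>3/4 p + m (s - r)\<close> for some \<open>s\<close> with probability at most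
  \<open>exp (- 3/2 m p)\<close>. To let \<open>r\<close> vary as well, cut \<open>[0, T]\<close> into \<open>n\<close> cells, use this bound from the left
  end of the cell of \<open>r\<close>, and spend the remaining \<open>p / 4\<close> on the motion inside the cell: the
  condition on \<open>n\<close> makes the cells so short that an oscillation by \<open>p / 8\<close> is unlikely enough. The
  sign \<open>c\<close> serves to treat \<open>B\<close> and \<open>- B\<close> together.\<close>

lemma increments_bound:
  assumes c: "c\<^sup>2 = (1 :: real)" and m: "0 < m" and p: "0 < p" and T: "0 < T"
    and n: "128 * m * T \<le> real n * p"
  shows "\<exists>N\<in>events. prob N \<le> 2 * real n * exp (- (m * p)) \<and>
    (AE \<omega> in M. \<omega> \<notin> N \<longrightarrow>
      (\<forall>r s. 0 \<le> r \<longrightarrow> r \<le> s \<longrightarrow> s \<le> T \<longrightarrow> c * (B s \<omega> - B r \<omega>) \<le> p + m * (s - r)))"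
proof -
  have n0: "0 < n" 
  proof (rule ccontr)
    assume "\<not> 0 < n"
    moreover have "0 < 128 * m * T" using m T by simp
    ultimately show False using n by simp
  qed
  define \<epsilon> where "\<epsilon> = T / real n"
  have \<epsilon>: "0 < \<epsilon>" "real n * \<epsilon> = T" using T n0 by (auto simp: \<epsilon>_def)
  have m\<epsilon>: "m * \<epsilon> \<le> p / 128" using n n0 by (simp add: \<epsilon>_def field_simps)
  \<comment> \<open>The exponential weight that is optimal for an oscillation of size \<open>p / 8\<close> during a time \<open>\<epsilon>\<close>.\<close>
  define \<mu> where "\<mu> = p / (8 * \<epsilon>)"
  have \<mu>: "0 < \<mu>" "\<mu> * \<epsilon> = p / 8" using p \<epsilon> by (auto simp: \<mu>_def)
  have \<mu>p: "m * p \<le> \<mu> * p / 16"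
  proof -
    have "m \<le> p / (128 * \<epsilon>)" using m\<epsilon> \<epsilon> by (simp add: field_simps)
    also have "\<dots> = \<mu> / 16" by (simp add: \<mu>_def)
    finally show ?thesis using mult_right_mono[of m "\<mu> / 16" p] p by simp
  qed
  have t0: "0 \<le> real i * \<epsilon>" for i :: nat using \<epsilon> by simp
  have "\<exists>E. \<forall>i. E i \<in> events \<and> prob (E i) \<le> exp (- (3 / 2 * m * p)) \<and>
    (AE \<omega> in M. \<omega> \<notin> E i \<longrightarrow> (\<forall>s\<in>{0..T}.
      (2 * m * c) * (B (real i * \<epsilon> + s) \<omega> - B (real i * \<epsilon>) \<omega>) - (2 * m * c)\<^sup>2 * s / 2 \<le> 3 / 2 * m * p))"
    by (intro choice allI) (use maximal_inequality[OF t0 T] in blast)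
  then obtain E where E: "\<And>i. E i \<in> events" "\<And>i. prob (E i) \<le> exp (- (3 / 2 * m * p))"
    "\<And>i. AE \<omega> in M. \<omega> \<notin> E i \<longrightarrow> (\<forall>s\<in>{0..T}.
      (2 * m * c) * (B (real i * \<epsilon> + s) \<omega> - B (real i * \<epsilon>) \<omega>) - (2 * m * c)\<^sup>2 * s / 2 \<le> 3 / 2 * m * p)"
    by blast
  have "\<exists>F. \<forall>i. F i \<in> events \<and> prob (F i) \<le> exp (- (\<mu> * p / 16)) \<and>
    (AE \<omega> in M. \<omega> \<notin> F i \<longrightarrow> (\<forall>s\<in>{0..\<epsilon>}.
      (- \<mu> * c) * (B (real i * \<epsilon> + s) \<omega> - B (real i * \<epsilon>) \<omega>) - (- \<mu> * c)\<^sup>2 * s / 2 \<le> \<mu> * p / 16))"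
    by (intro choice allI) (use maximal_inequality[OF t0 \<epsilon>(1)] in blast)
  then obtain F where F: "\<And>i. F i \<in> events" "\<And>i. prob (F i) \<le> exp (- (\<mu> * p / 16))"
    "\<And>i. AE \<omega> in M. \<omega> \<notin> F i \<longrightarrow> (\<forall>s\<in>{0..\<epsilon>}.
      (- \<mu> * c) * (B (real i * \<epsilon> + s) \<omega> - B (real i * \<epsilon>) \<omega>) - (- \<mu> * c)\<^sup>2 * s / 2 \<le> \<mu> * p / 16)"
    by blast
  let ?N = "\<Union>i<n. E i \<union> F i"
  have "prob ?N \<le> (\<Sum>i<n. prob (E i \<union> F i))"
    using E(1) F(1) by (intro finite_measure_subadditive_finite) auto
  also have "\<dots> \<le> (\<Sum>i<n. 2 * exp (- (m * p)))"
  proof (rule sum_mono)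
    fix i
    have "prob (E i \<union> F i) \<le> prob (E i) + prob (F i)"
      by (rule measure_Un_le[OF E(1) F(1)])
    moreover have "exp (- (3 / 2 * m * p)) \<le> exp (- (m * p))" using m p by simp
    moreover have "exp (- (\<mu> * p / 16)) \<le> exp (- (m * p))" using \<mu>p by simp
    ultimately show "prob (E i \<union> F i) \<le> 2 * exp (- (m * p))"
      using E(2)[of i] F(2)[of i] by linarith
  qed
  finally have prob: "prob ?N \<le> 2 * real n * exp (- (m * p))" by simp
  have "AE \<omega> in M. \<forall>i. \<omega> \<notin> E i \<longrightarrow> (\<forall>s\<in>{0..T}.
      (2 * m * c) * (B (real i * \<epsilon> + s) \<omega> - B (real i * \<epsilon>) \<omega>) - (2 * m * c)\<^sup>2 * s / 2 \<le> 3 / 2 * m * p)"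
    using E(3) by (simp only: AE_all_countable) blast
  moreover have "AE \<omega> in M. \<forall>i. \<omega> \<notin> F i \<longrightarrow> (\<forall>s\<in>{0..\<epsilon>}.
      (- \<mu> * c) * (B (real i * \<epsilon> + s) \<omega> - B (real i * \<epsilon>) \<omega>) - (- \<mu> * c)\<^sup>2 * s / 2 \<le> \<mu> * p / 16)"
    using F(3) by (simp only: AE_all_countable) blast
  ultimately have "AE \<omega> in M. \<omega> \<notin> ?N \<longrightarrow>
    (\<forall>r s. 0 \<le> r \<longrightarrow> r \<le> s \<longrightarrow> s \<le> T \<longrightarrow> c * (B s \<omega> - B r \<omega>) \<le> p + m * (s - r))"
  proof eventually_elim
    case (elim \<omega>)
    show ?case
    proof (intro impI allI)
      fix r s assume N: "\<omega> \<notin> ?N" and rs: "0 \<le> r" "r \<le> s" "s \<le> T"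
      obtain i where i: "i < n" "real i * \<epsilon> \<le> r" "r \<le> real i * \<epsilon> + \<epsilon>"
      proof (cases "r = T")
        case True
        have "real (n - 1) * \<epsilon> + \<epsilon> = T" using n0 \<epsilon>(2) by (simp add: of_nat_diff algebra_simps)
        then show ?thesis using that[of "n - 1"] n0 True \<epsilon>(1) by simp
      next
        case False
        define i where "i = nat \<lfloor>r / \<epsilon>\<rfloor>"
        have i: "real i \<le> r / \<epsilon>" "r / \<epsilon> \<le> real i + 1"
          using rs \<epsilon> unfolding i_def by (auto simp: of_nat_nat)
        then have i': "real i * \<epsilon> \<le> r" "r \<le> real i * \<epsilon> + \<epsilon>" using \<epsilon>(1) by (auto simp: field_simps)
        then have "real i * \<epsilon> < real n * \<epsilon>" using False rs \<epsilon>(2) by linarith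
        then have "i < n" using \<epsilon>(1) by simp
        then show ?thesis using that i' by blast
      qed
      let ?t = "real i * \<epsilon>"
      have "(2 * m * c) * (B (?t + (s - ?t)) \<omega> - B ?t \<omega>) - (2 * m * c)\<^sup>2 * (s - ?t) / 2 \<le> 3 / 2 * m * p"
      proof (rule elim(1)[rule_format])
        show "\<omega> \<notin> E i" using N i by blast
        show "s - ?t \<in> {0..T}"
          unfolding atLeastAtMost_iff using i rs t0[of i] by (intro conjI) linarith+
      qed
      moreover have "(2 * m * c)\<^sup>2 * (s - ?t) / 2 = 2 * m * (m * (s - ?t))"
        using c by (simp add: power_mult_distrib power2_eq_square)
      moreover have "2 * m * (3 / 4 * p + m * (s - ?t)) = 3 / 2 * m * p + 2 * m * (m * (s - ?t))"
        by (simp add: distrib_left)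
      moreover have "?t + (s - ?t) = s" "(2 * m) * (c * (B s \<omega> - B ?t \<omega>)) = (2 * m * c) * (B s \<omega> - B ?t \<omega>)"
        by simp_all
      ultimately have "(2 * m) * (c * (B s \<omega> - B ?t \<omega>)) \<le> (2 * m) * (3 / 4 * p + m * (s - ?t))"
        by simp
      then have 1: "c * (B s \<omega> - B ?t \<omega>) \<le> 3 / 4 * p + m * (s - ?t)"
        using m by (subst (asm) mult_le_cancel_left_pos) auto
      have "(- \<mu> * c) * (B (?t + (r - ?t)) \<omega> - B ?t \<omega>) - (- \<mu> * c)\<^sup>2 * (r - ?t) / 2 \<le> \<mu> * p / 16"
      proof (rule elim(2)[rule_format])
        show "\<omega> \<notin> F i" using N i by blast
        show "r - ?t \<in> {0..\<epsilon>}"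
          unfolding atLeastAtMost_iff using i by (intro conjI) linarith+
      qed
      then have "\<mu> * (- c * (B r \<omega> - B ?t \<omega>)) \<le> \<mu> * p / 16 + \<mu>\<^sup>2 * (r - ?t) / 2"
        using c by (simp add: power_mult_distrib)
      also have "\<mu>\<^sup>2 * (r - ?t) / 2 \<le> \<mu>\<^sup>2 * \<epsilon> / 2"
        using i by (intro divide_right_mono mult_left_mono) auto
      also have "\<mu>\<^sup>2 * \<epsilon> / 2 = \<mu> * p / 16" using \<mu>(2) by (simp add: power2_eq_square mult_ac)
      finally have "\<mu> * (- c * (B r \<omega> - B ?t \<omega>)) \<le> \<mu> * (p / 8)" by simp
      then have 2: "- c * (B r \<omega> - B ?t \<omega>) \<le> p / 8"
        using \<mu>(1) by (subst (asm) mult_le_cancel_left_pos) auto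
      have "m * (r - ?t) \<le> m * \<epsilon>" using i m by (intro mult_left_mono) auto
      moreover have "m * (s - ?t) = m * (s - r) + m * (r - ?t)" by (simp add: algebra_simps)
      moreover have "c * (B s \<omega> - B r \<omega>) = c * (B s \<omega> - B ?t \<omega>) + - c * (B r \<omega> - B ?t \<omega>)"
        by (simp add: algebra_simps)
      ultimately show "c * (B s \<omega> - B r \<omega>) \<le> p + m * (s - r)" using 1 2 m\<epsilon> p by linarith
    qed
  qed
  with prob show ?thesis using E(1) F(1) by (intro bexI[of _ ?N]) auto
qed

text \<open>The normal density is bounded below by its value at distance \<open>z + 1\<close> on an interval of
  length one beyond \<open>z\<close>.\<close>

lemma tail_ge:
  assumes c: "c\<^sup>2 = (1 :: real)" and T: "0 < T" and z: "0 \<le> z"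
  shows "ennreal (exp (- ((z + 1)\<^sup>2 / (2 * T))) / sqrt (2 * pi * T)) \<le>
    emeasure M {\<omega> \<in> space M. z < c * (B T \<omega> - B 0 \<omega>)}"
proof -
  let ?K = "exp (- ((z + 1)\<^sup>2 / (2 * T))) / sqrt (2 * pi * T)"
  let ?A = "{x. z < c * x}"
  have c': "c = 1 \<or> c = -1" using c by (simp add: power2_eq_1_iff)
  define q where "q = (if c = 1 then z else - (z + 1))"
  have sub: "z < c * x \<and> \<bar>x\<bar> \<le> z + 1" if "x \<in> {q<..<q + 1}" for x
    using c' that z by (auto simp: q_def split: if_splits)
  have dist: "distributed M lborel (\<lambda>\<omega>. B T \<omega> - B 0 \<omega>) (normal_density 0 (sqrt (T - 0)))"
    by (rule normal_increments) (use T in auto)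
  have "ennreal ?K = (\<integral>\<^sup>+x. ennreal ?K * indicator {q<..<q + 1} x \<partial>lborel)"
    by (subst nn_integral_cmult_indicator) auto
  also have "\<dots> \<le> (\<integral>\<^sup>+x. ennreal (normal_density 0 (sqrt (T - 0)) x) * indicator ?A x \<partial>lborel)"
  proof (rule nn_integral_mono)
    fix x
    show "ennreal ?K * indicator {q<..<q + 1} x \<le> ennreal (normal_density 0 (sqrt (T - 0)) x) * indicator ?A x"
    proof (cases "x \<in> {q<..<q + 1}")
      case True
      have "\<bar>x\<bar>\<^sup>2 \<le> (z + 1)\<^sup>2" using sub[OF True] by (intro power_mono) auto
      then have "exp (- ((z + 1)\<^sup>2 / (2 * T))) \<le> exp (- x\<^sup>2 / (2 * T))"
        using T by (simp add: divide_right_mono)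
      then have "?K \<le> normal_density 0 (sqrt (T - 0)) x"
        using T by (simp add: normal_density_def divide_right_mono)
      then show ?thesis using sub[OF True] True by (simp add: ennreal_leI)
    qed simp
  qed
  also have "\<dots> = emeasure M ((\<lambda>\<omega>. B T \<omega> - B 0 \<omega>) -` ?A \<inter> space M)"
    by (rule distributed_emeasure[OF dist, symmetric]) simp
  also have "(\<lambda>\<omega>. B T \<omega> - B 0 \<omega>) -` ?A \<inter> space M = {\<omega> \<in> space M. z < c * (B T \<omega> - B 0 \<omega>)}"
    by auto
  finally show ?thesis .
qed

end

section \<open>Tail recursions and invariance\<close>

text \<open>Iterating the hypothesis along \<open>x, 2 x, 4 x, \<dots>\<close> leaves a sum of errors, which is dominated by a
  geometric series since \<open>(2 ^ k x) ^ p \<ge> x ^ p + k x0 ^ p\<close>.\<close>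

lemma doubling_bound:
  fixes F :: "real \<Rightarrow> real"
  assumes lim: "(F \<longlongrightarrow> 0) at_top" and p: "1 \<le> p" and pos: "0 < x0" "0 < \<kappa>" "0 \<le> K"
    and step: "\<And>x. x0 \<le> x \<Longrightarrow> F x \<le> F (2 * x) + K * exp (- (\<kappa> * x ^ p))"
    and x: "x0 \<le> x"
  shows "F x \<le> K / (1 - exp (- (\<kappa> * x0 ^ p))) * exp (- (\<kappa> * x ^ p))"
proof -
  define q where "q = exp (- (\<kappa> * x0 ^ p))"
  have q: "0 < q" "q < 1" using pos by (auto simp: q_def)
  have term_le: "exp (- (\<kappa> * (2 ^ k * x) ^ p)) \<le> exp (- (\<kappa> * x ^ p)) * q ^ k" for k :: nat
  proof -
    have "1 + real k \<le> (1 + 1) ^ k" using Bernoulli_inequality[of 1 k] by simp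
    also have "\<dots> = 2 ^ k" by simp
    also have "(2 :: real) ^ k \<le> (2 ^ k) ^ p" using p by (intro self_le_power) auto
    finally have "(1 + real k) * x ^ p \<le> (2 ^ k) ^ p * x ^ p"
      using pos x by (intro mult_right_mono) auto
    moreover have "real k * x0 ^ p \<le> real k * x ^ p"
      using pos x by (intro mult_left_mono power_mono) auto
    ultimately have "x ^ p + real k * x0 ^ p \<le> (2 ^ k * x) ^ p"
      by (simp add: power_mult_distrib distrib_right)
    then have "\<kappa> * (x ^ p + real k * x0 ^ p) \<le> \<kappa> * (2 ^ k * x) ^ p"
      using pos by (intro mult_left_mono) auto
    then have "- (\<kappa> * (2 ^ k * x) ^ p) \<le> - (\<kappa> * x ^ p) + real k * (- (\<kappa> * x0 ^ p))"
      by (simp add: distrib_left mult.left_commute)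
    then have "exp (- (\<kappa> * (2 ^ k * x) ^ p)) \<le> exp (- (\<kappa> * x ^ p) + real k * (- (\<kappa> * x0 ^ p)))"
      by simp
    also have "\<dots> = exp (- (\<kappa> * x ^ p)) * q ^ k"
      unfolding q_def exp_add exp_of_nat_mult by simp
    finally show ?thesis .
  qed
  have iter: "F x \<le> F (2 ^ N * x) + (\<Sum>k<N. K * exp (- (\<kappa> * (2 ^ k * x) ^ p)))" for N :: nat
  proof (induction N)
    case (Suc N)
    have "1 * x \<le> 2 ^ N * x" using pos x by (intro mult_right_mono) auto
    then have "x0 \<le> 2 ^ N * x" using x by simp
    from step[OF this] Suc show ?case unfolding sum.lessThan_Suc power_Suc mult.assoc by linarith
  qed simp
  have bound: "F x \<le> F (2 ^ N * x) + K / (1 - q) * exp (- (\<kappa> * x ^ p))" for N :: nat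
  proof -
    have "(\<Sum>k<N. K * exp (- (\<kappa> * (2 ^ k * x) ^ p))) \<le> (\<Sum>k<N. K * (exp (- (\<kappa> * x ^ p)) * q ^ k))"
      using pos by (intro sum_mono mult_left_mono term_le) auto
    also have "\<dots> = K * exp (- (\<kappa> * x ^ p)) * (\<Sum>k<N. q ^ k)"
      by (simp add: sum_distrib_left mult.assoc)
    also have "(\<Sum>k<N. q ^ k) \<le> 1 / (1 - q)"
      using q by (subst sum_gp_strict) (auto intro!: divide_right_mono)
    finally show ?thesis using iter[of N] pos by (simp add: mult_left_mono)
  qed
  have "filterlim (\<lambda>N. 2 ^ N :: real) at_top sequentially"
    by (rule filterlim_at_infinity_imp_filterlim_at_top[OF filterlim_realpow_sequentially_gt1]) auto
  then have "filterlim (\<lambda>N. x * 2 ^ N) at_top sequentially"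
    using pos x by (intro filterlim_tendsto_pos_mult_at_top[OF tendsto_const]) auto
  then have "filterlim (\<lambda>N. 2 ^ N * x) at_top sequentially" by (simp only: mult.commute)
  from tendsto_add[OF filterlim_compose[OF lim this] tendsto_const]
  have "(\<lambda>N. F (2 ^ N * x) + K / (1 - q) * exp (- (\<kappa> * x ^ p))) \<longlonglongrightarrow> 0 + K / (1 - q) * exp (- (\<kappa> * x ^ p))" .
  then have "F x \<le> 0 + K / (1 - q) * exp (- (\<kappa> * x ^ p))"
    by (rule LIMSEQ_le_const) (use bound in blast)
  then show ?thesis unfolding q_def by simp
qed

lemma (in finite_measure) tendsto_measure_tail:
  fixes A :: "real \<Rightarrow> 'a set"
  assumes A: "\<And>x. A x \<in> sets M" and anti: "\<And>x y. x \<le> y \<Longrightarrow> A y \<subseteq> A x"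
    and empty: "(\<Inter>n. A (real n)) = {}"
  shows "((\<lambda>x. measure M (A x)) \<longlongrightarrow> 0) at_top"
proof (rule order_tendstoI)
  fix e :: real assume "0 < e"
  have "(\<lambda>n. measure M (A (real n))) \<longlonglongrightarrow> measure M (\<Inter>n. A (real n))"
    using A anti by (intro finite_Lim_measure_decseq) (auto simp: decseq_def)
  then have "eventually (\<lambda>n. measure M (A (real n)) < e) sequentially"
    using \<open>0 < e\<close> unfolding empty by (intro order_tendstoD(2)[where y = "measure M {}"]) auto
  then obtain n where "measure M (A (real n)) < e" by (auto simp: eventually_sequentially)
  then have "measure M (A x) < e" if "real n \<le> x" for x
    using finite_measure_mono[OF anti[OF that] A] by simp
  then show "eventually (\<lambda>x. measure M (A x) < e) at_top"
    by (auto simp: eventually_at_top_linorder)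
qed (auto intro!: always_eventually elim: less_le_trans)

text \<open>If, outside a small event, no path started outside \<open>A'\<close> is in \<open>A\<close> at time \<open>T\<close>, then invariance
  transfers the bound to \<open>\<pi>\<close>. The event is chosen before the starting point, so that a purely
  pathwise argument can supply the implication.\<close>

lemma stationary_measure_le:
  fixes A A' :: "(real \<times> real) set"
  assumes st: "inert_drift_stationary \<gamma> g \<pi>"
    and A: "A \<in> sets borel" and A': "A' \<in> sets borel" and T: "0 \<le> T" and p: "0 \<le> p"
    and step: "\<And>(M :: (real \<Rightarrow> real) measure) B. brownian_motion M B \<Longrightarrow>
      \<exists>N\<in>sets M. measure M N \<le> p \<and> (AE \<omega> in M. \<omega> \<notin> N \<longrightarrow>
        (\<forall>h v H V L. inert_drift_path \<gamma> g (h, v) (\<lambda>t. B t \<omega>) H V L \<longrightarrow> (h, v) \<notin> A' \<longrightarrow>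
          (H T, V T) \<notin> A))"
  shows "measure \<pi> A \<le> measure \<pi> A' + p"
proof -
  from st have "prob_space \<pi>" and sets: "sets \<pi> = sets borel"
    by (simp_all add: inert_drift_stationary_def)
  then interpret P: prob_space \<pi> by simp
  from st obtain M :: "(real \<Rightarrow> real) measure" and B H V L where BM: "brownian_motion M B"
    and proc: "\<And>z. z \<in> state_space \<gamma> g \<Longrightarrow> inert_drift_process M B \<gamma> g z (H z) (V z) (L z)"
    and inv: "emeasure \<pi> A =
      (\<integral>\<^sup>+z\<in>state_space \<gamma> g. emeasure M {\<omega> \<in> space M. (H z T \<omega>, V z T \<omega>) \<in> A} \<partial>\<pi>)"
    using T A unfolding inert_drift_stationary_def by blast
  interpret brownian_motion M B by fact
  from step[OF BM] obtain N where N: "N \<in> sets M" "measure M N \<le> p"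
    and good: "AE \<omega> in M. \<omega> \<notin> N \<longrightarrow>
      (\<forall>h v H V L. inert_drift_path \<gamma> g (h, v) (\<lambda>t. B t \<omega>) H V L \<longrightarrow> (h, v) \<notin> A' \<longrightarrow> (H T, V T) \<notin> A)"
    by blast
  have le: "emeasure M {\<omega> \<in> space M. (H z T \<omega>, V z T \<omega>) \<in> A} \<le> indicator A' z + ennreal p"
    if z: "z \<in> state_space \<gamma> g" for z
  proof (cases "z \<in> A'")
    case True
    have "emeasure M {\<omega> \<in> space M. (H z T \<omega>, V z T \<omega>) \<in> A} \<le> 1"
      by (rule measure_le_1)
    also have "\<dots> \<le> indicator A' z + ennreal p" using True by simp
    finally show ?thesis .
  next
    case False
    obtain h v where hv: "z = (h, v)" by fastforce
    have "AE \<omega> in M. inert_drift_path \<gamma> g (h, v) (\<lambda>t. B t \<omega>) (\<lambda>t. H z t \<omega>) (\<lambda>t. V z t \<omega>) (\<lambda>t. L z t \<omega>)"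
      using proc[OF z] unfolding inert_drift_process_def hv by blast
    with good have "AE \<omega> in M. \<omega> \<in> {\<omega> \<in> space M. (H z T \<omega>, V z T \<omega>) \<in> A} \<longrightarrow> \<omega> \<in> N"
      by eventually_elim (use False hv in blast)
    then have "emeasure M {\<omega> \<in> space M. (H z T \<omega>, V z T \<omega>) \<in> A} \<le> emeasure M N"
      by (rule emeasure_mono_AE) (rule N(1))
    also have "\<dots> \<le> ennreal p" using N(2) by (simp add: emeasure_eq_measure ennreal_leI)
    also have "\<dots> \<le> indicator A' z + ennreal p" by simp
    finally show ?thesis .
  qed
  have "emeasure \<pi> A \<le> (\<integral>\<^sup>+z. indicator A' z + ennreal p \<partial>\<pi>)"
    unfolding inv
  proof (rule nn_integral_mono)
    fix z
    show "emeasure M {\<omega> \<in> space M. (H z T \<omega>, V z T \<omega>) \<in> A} * indicator (state_space \<gamma> g) z \<le>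
        indicator A' z + ennreal p"
      using le[of z] by (cases "z \<in> state_space \<gamma> g") simp_all
  qed
  also have "\<dots> = emeasure \<pi> A' + ennreal p"
    using A' sets by (subst nn_integral_add) (auto simp: P.emeasure_space_1)
  finally show ?thesis
    using p by (simp add: P.emeasure_eq_measure flip: ennreal_plus)
qed

lemma stationary_measure_ge:
  fixes A K :: "(real \<times> real) set"
  assumes st: "inert_drift_stationary \<gamma> g \<pi>"
    and A: "A \<in> sets borel" and K: "K \<in> sets borel" and T: "0 \<le> T" and p: "0 \<le> p"
    and step: "\<And>(M :: (real \<Rightarrow> real) measure) B. brownian_motion M B \<Longrightarrow>
      \<exists>E\<in>sets M. ennreal p \<le> emeasure M E \<and> (\<forall>\<omega>\<in>E.
        \<forall>h v H V L. inert_drift_path \<gamma> g (h, v) (\<lambda>t. B t \<omega>) H V L \<longrightarrow> (h, v) \<in> K \<longrightarrow>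
          (H T, V T) \<in> A)"
  shows "measure \<pi> K * p \<le> measure \<pi> A"
proof -
  from st have "prob_space \<pi>" and sets: "sets \<pi> = sets borel"
    and supp: "emeasure \<pi> (- state_space \<gamma> g) = 0"
    by (simp_all add: inert_drift_stationary_def)
  then interpret P: prob_space \<pi> by simp
  from st obtain M :: "(real \<Rightarrow> real) measure" and B H V L where BM: "brownian_motion M B"
    and proc: "\<And>z. z \<in> state_space \<gamma> g \<Longrightarrow> inert_drift_process M B \<gamma> g z (H z) (V z) (L z)"
    and inv: "emeasure \<pi> A =
      (\<integral>\<^sup>+z\<in>state_space \<gamma> g. emeasure M {\<omega> \<in> space M. (H z T \<omega>, V z T \<omega>) \<in> A} \<partial>\<pi>)"
    using T A unfolding inert_drift_stationary_def by blast
  interpret brownian_motion M B by fact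
  have S: "state_space \<gamma> g \<in> sets \<pi>"
    unfolding sets state_space_def by (intro borel_Times) auto
  from step[OF BM] obtain E where E: "E \<in> sets M" "ennreal p \<le> emeasure M E"
    and good: "\<And>\<omega> h v H V L. \<omega> \<in> E \<Longrightarrow> inert_drift_path \<gamma> g (h, v) (\<lambda>t. B t \<omega>) H V L \<Longrightarrow>
      (h, v) \<in> K \<Longrightarrow> (H T, V T) \<in> A"
    by blast
  have ge: "ennreal p \<le> emeasure M {\<omega> \<in> space M. (H z T \<omega>, V z T \<omega>) \<in> A}"
    if z: "z \<in> state_space \<gamma> g" "z \<in> K" for z
  proof -
    obtain h v where hv: "z = (h, v)" by fastforce
    have HV[measurable]: "H z T \<in> borel_measurable M" "V z T \<in> borel_measurable M"
      using proc[OF z(1)] T unfolding inert_drift_process_def by blast+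
    have "(\<lambda>\<omega>. (H z T \<omega>, V z T \<omega>)) \<in> borel_measurable M" by simp
    then have sets: "{\<omega> \<in> space M. (H z T \<omega>, V z T \<omega>) \<in> A} \<in> sets M"
      using measurable_sets[of _ M borel A] A by (simp add: vimage_def Int_def conj_commute)
    have "AE \<omega> in M. inert_drift_path \<gamma> g (h, v) (\<lambda>t. B t \<omega>) (\<lambda>t. H z t \<omega>) (\<lambda>t. V z t \<omega>) (\<lambda>t. L z t \<omega>)"
      using proc[OF z(1)] unfolding inert_drift_process_def hv by blast
    then have "AE \<omega> in M. \<omega> \<in> E \<longrightarrow> \<omega> \<in> {\<omega> \<in> space M. (H z T \<omega>, V z T \<omega>) \<in> A}"
      using AE_space by eventually_elim (use good z(2) hv in blast)
    then have "emeasure M E \<le> emeasure M {\<omega> \<in> space M. (H z T \<omega>, V z T \<omega>) \<in> A}"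
      by (rule emeasure_mono_AE) (rule sets)
    with E(2) show ?thesis by (rule order_trans)
  qed
  have "emeasure \<pi> K \<le> emeasure \<pi> (K \<inter> state_space \<gamma> g)"
  proof (rule emeasure_mono_AE)
    have "- state_space \<gamma> g \<in> null_sets \<pi>"
      using supp S sets by (auto simp: null_sets_def)
    then have "AE z in \<pi>. z \<notin> - state_space \<gamma> g" by (rule AE_not_in)
    then show "AE z in \<pi>. z \<in> K \<longrightarrow> z \<in> K \<inter> state_space \<gamma> g" by eventually_elim auto
    show "K \<inter> state_space \<gamma> g \<in> sets \<pi>" using K S sets by auto
  qed
  then have "emeasure \<pi> K * ennreal p \<le> ennreal p * emeasure \<pi> (K \<inter> state_space \<gamma> g)"
    by (simp add: mult.commute mult_left_mono)
  also have "\<dots> = (\<integral>\<^sup>+z. ennreal p * indicator (K \<inter> state_space \<gamma> g) z \<partial>\<pi>)"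
    using K S sets by (subst nn_integral_cmult_indicator) auto
  also have "\<dots> \<le> emeasure \<pi> A"
    unfolding inv
  proof (rule nn_integral_mono)
    fix z
    show "ennreal p * indicator (K \<inter> state_space \<gamma> g) z \<le>
        emeasure M {\<omega> \<in> space M. (H z T \<omega>, V z T \<omega>) \<in> A} * indicator (state_space \<gamma> g) z"
      using ge[of z] by (cases "z \<in> K \<inter> state_space \<gamma> g") simp_all
  qed
  finally show ?thesis
    using p by (simp add: P.emeasure_eq_measure flip: ennreal_mult)
qed

section \<open>Tails of the stationary law\<close>

lemma measurable_tail_sets:
  "{0..} \<times> {y<..} \<in> sets (borel :: (real \<times> real) measure)"
  "{x<..} \<times> UNIV \<in> sets (borel :: (real \<times> real) measure)"
  by (intro borel_Times; simp)+

text \<open>The time \<open>T\<close> is fixed, so that the number \<open>n\<close> of cells required by \<open>increments_bound\<close> depends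
  only on \<open>\<gamma>\<close>; slope \<open>(1 + \<gamma>) u / 4\<close> and allowance \<open>u / 2\<close> give the exponent \<open>(1 + \<gamma>) u\<^sup>2 / 8\<close>.\<close>

lemma V_tail_le:
  fixes \<gamma> g :: real
  assumes \<gamma>: "0 < \<gamma>" and g: "0 < g"
  shows "\<exists>K>0. \<forall>\<pi>. inert_drift_stationary \<gamma> g \<pi> \<longrightarrow> (\<forall>u\<ge>1.
    measure \<pi> ({0..} \<times> {u - g / (1 + \<gamma>)<..}) \<le> K * exp (- ((1 + \<gamma>) / 8 * u\<^sup>2)))"
proof -
  \<comment> \<open>The two summands meet the two conditions on \<open>T\<close> in \<open>V_le_level\<close>.\<close>
  define T where "T = 12 / (1 + \<gamma>) + 10 / \<gamma>"
  define n where "n = nat \<lceil>64 * (1 + \<gamma>) * T\<rceil>"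
  have T: "0 < T" "12 \<le> (1 + \<gamma>) * T" "exp (- \<gamma> * T / 2) \<le> 1 / 5"
  proof -
    show "0 < T" using \<gamma> by (simp add: T_def add_pos_pos)
    have "1 + \<gamma> \<noteq> 0" using \<gamma> by simp
    then have "(1 + \<gamma>) * (12 / (1 + \<gamma>)) = 12"
      by (metis nonzero_mult_div_cancel_left times_divide_eq_right)
    then have "(1 + \<gamma>) * T = 12 + (1 + \<gamma>) * (10 / \<gamma>)"
      unfolding T_def distrib_left[of "1 + \<gamma>"] by linarith
    then show "12 \<le> (1 + \<gamma>) * T" using \<gamma> by simp
    have "\<gamma> * T = 10 + \<gamma> * (12 / (1 + \<gamma>))" using \<gamma> by (simp add: T_def distrib_left)
    then have "10 \<le> \<gamma> * T" using \<gamma> by simp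
    then have "exp (- \<gamma> * T / 2) \<le> exp (- 5)" by simp
    also have "exp (- 5) \<le> 1 / (5 :: real)"
    proof -
      have "5 \<le> exp (5 :: real)" using exp_ge_add_one_self[of 5] by linarith
      then have "inverse (exp 5) \<le> inverse (5 :: real)" by (intro le_imp_inverse_le) auto
      then show ?thesis by (simp add: exp_minus inverse_eq_divide)
    qed
    finally show "exp (- \<gamma> * T / 2) \<le> 1 / 5" .
  qed
  have "64 * (1 + \<gamma>) * T \<le> real n" unfolding n_def by linarith
  moreover have "0 < 64 * (1 + \<gamma>) * T" using T \<gamma> by simp
  ultimately have n: "64 * (1 + \<gamma>) * T \<le> real n" "0 < real n" by linarith+
  let ?K = "2 * real n / (1 - exp (- ((1 + \<gamma>) / 8 * 1\<^sup>2)))"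
  have "measure \<pi> ({0..} \<times> {u - g / (1 + \<gamma>)<..}) \<le> ?K * exp (- ((1 + \<gamma>) / 8 * u\<^sup>2))"
    if st: "inert_drift_stationary \<gamma> g \<pi>" and u: "1 \<le> u" for \<pi> u
  proof (rule doubling_bound[where F = "\<lambda>u. measure \<pi> ({0..} \<times> {u - g / (1 + \<gamma>)<..})" and p = 2, OF _ _ _ _ _ _ u])
    interpret P: prob_space \<pi> using st by (simp add: inert_drift_stationary_def)
    have sets: "sets \<pi> = sets borel" using st by (simp add: inert_drift_stationary_def)
    show "((\<lambda>u. measure \<pi> ({0..} \<times> {u - g / (1 + \<gamma>)<..})) \<longlongrightarrow> 0) at_top"
    proof (rule P.tendsto_measure_tail)
      show "(\<Inter>n. {0..} \<times> {real n - g / (1 + \<gamma>)<..}) = ({} :: (real \<times> real) set)"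
      proof safe
        fix h v assume "(h, v) \<in> (\<Inter>n. {0..} \<times> {real n - g / (1 + \<gamma>)<..})"
        then have "real n < v + g / (1 + \<gamma>)" for n by (auto simp: algebra_simps)
        then show "(h, v) \<in> {}" using reals_Archimedean2[of "v + g / (1 + \<gamma>)"] less_asym by blast
      qed
    qed (use sets measurable_tail_sets in auto)
    fix u :: real assume u: "1 \<le> u"
    have "measure \<pi> ({0..} \<times> {u - g / (1 + \<gamma>)<..}) \<le> measure \<pi> ({0..} \<times> {2 * u - g / (1 + \<gamma>)<..}) +
        2 * real n * exp (- ((1 + \<gamma>) / 8 * u\<^sup>2))"
    proof (rule stationary_measure_le[OF st measurable_tail_sets(1) measurable_tail_sets(1) less_imp_le[OF T(1)]])
      fix M :: "(real \<Rightarrow> real) measure" and B assume "brownian_motion M B"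
      then interpret brownian_motion M B .
      have "\<exists>N\<in>events. prob N \<le> 2 * real n * exp (- ((1 + \<gamma>) * u / 4 * (u / 2))) \<and>
        (AE \<omega> in M. \<omega> \<notin> N \<longrightarrow> (\<forall>r s. 0 \<le> r \<longrightarrow> r \<le> s \<longrightarrow> s \<le> T \<longrightarrow>
          1 * (B s \<omega> - B r \<omega>) \<le> u / 2 + (1 + \<gamma>) * u / 4 * (s - r)))"
      proof (rule increments_bound)
        have "64 * (1 + \<gamma>) * T * (u / 2) \<le> real n * (u / 2)" using n u by (intro mult_right_mono) auto
        moreover have "128 * ((1 + \<gamma>) * u / 4) * T = 64 * (1 + \<gamma>) * T * (u / 2)" by simp
        ultimately show "128 * ((1 + \<gamma>) * u / 4) * T \<le> real n * (u / 2)" by (simp only:)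
      qed (use u \<gamma> T in auto)
      then obtain N where N: "N \<in> events" "prob N \<le> 2 * real n * exp (- ((1 + \<gamma>) / 8 * u\<^sup>2))"
        and inc: "AE \<omega> in M. \<omega> \<notin> N \<longrightarrow> (\<forall>r s. 0 \<le> r \<longrightarrow> r \<le> s \<longrightarrow> s \<le> T \<longrightarrow>
          B s \<omega> - B r \<omega> \<le> u / 2 + (1 + \<gamma>) * u / 4 * (s - r))"
        by (auto simp: power2_eq_square mult.assoc)
      have "V T \<le> u - g / (1 + \<gamma>)"
        if path: "inert_drift_path \<gamma> g (h, v) (\<lambda>t. B t \<omega>) H V L"
          and inc: "\<forall>r s. 0 \<le> r \<longrightarrow> r \<le> s \<longrightarrow> s \<le> T \<longrightarrow> B s \<omega> - B r \<omega> \<le> u / 2 + (1 + \<gamma>) * u / 4 * (s - r)"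
          and z: "(h, v) \<notin> {0..} \<times> {2 * u - g / (1 + \<gamma>)<..}" for \<omega> h v H V L
      proof -
        interpret inert_path \<gamma> g h v "\<lambda>t. B t \<omega>" H V L using \<gamma> g path by unfold_locales
        have "0 \<le> h" using H_nonneg[OF order_refl] H_0 by simp
        then have "v + g / (1 + \<gamma>) \<le> 2 * u" using z by auto
        then have "V T + g / (1 + \<gamma>) \<le> u" using u inc by (intro V_le_level T) auto
        then show ?thesis by linarith
      qed
      then show "\<exists>N\<in>events. prob N \<le> 2 * real n * exp (- ((1 + \<gamma>) / 8 * u\<^sup>2)) \<and>
        (AE \<omega> in M. \<omega> \<notin> N \<longrightarrow> (\<forall>h v H V L. inert_drift_path \<gamma> g (h, v) (\<lambda>t. B t \<omega>) H V L \<longrightarrow>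
          (h, v) \<notin> {0..} \<times> {2 * u - g / (1 + \<gamma>)<..} \<longrightarrow> (H T, V T) \<notin> {0..} \<times> {u - g / (1 + \<gamma>)<..}))"
        using N inc by (intro bexI[of _ N] conjI) (auto elim!: eventually_mono simp: not_less)
    qed simp
    then show "measure \<pi> ({0..} \<times> {u - g / (1 + \<gamma>)<..}) \<le> measure \<pi> ({0..} \<times> {2 * u - g / (1 + \<gamma>)<..}) +
        2 * real n * exp (- ((1 + \<gamma>) / 8 * u\<^sup>2))" .
  qed (use \<gamma> in auto)
  moreover have "0 < ?K" using n \<gamma> by (intro divide_pos_pos) auto
  ultimately show ?thesis by blast
qed

text \<open>For the tail of \<open>H\<close> the number of cells grows linearly with the level; this factor is harmless
  in front of a Gaussian term.\<close>

lemma linear_times_gaussian_le: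
  fixes x :: real
  assumes "0 < \<alpha>" "0 \<le> C1" "0 \<le> C2" "0 \<le> x" "(1 + \<beta>) / \<alpha> \<le> x"
  shows "(C1 + C2 * x) * exp (- (\<alpha> * x\<^sup>2)) \<le> (C1 + C2) * exp (- (\<beta> * x))"
proof -
  have "1 \<le> exp x" "x \<le> exp x" using assms(4) exp_ge_add_one_self[of x] by linarith+
  then have "C1 * 1 + C2 * x \<le> C1 * exp x + C2 * exp x"
    using assms by (intro add_mono mult_left_mono)
  then have "(C1 + C2 * x) * exp (- (\<alpha> * x\<^sup>2)) \<le> (C1 + C2) * exp x * exp (- (\<alpha> * x\<^sup>2))"
    by (intro mult_right_mono) (auto simp: distrib_right)
  also have "\<dots> = (C1 + C2) * exp (x - \<alpha> * x\<^sup>2)" by (simp add: mult.assoc exp_diff exp_minus divide_inverse)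
  also have "1 + \<beta> \<le> \<alpha> * x" using assms by (simp add: divide_le_eq mult.commute)
  then have "(1 + \<beta>) * x \<le> \<alpha> * x * x" using assms by (intro mult_right_mono)
  then have "x - \<alpha> * x\<^sup>2 \<le> - (\<beta> * x)" by (simp add: power2_eq_square algebra_simps)
  then have "(C1 + C2) * exp (x - \<alpha> * x\<^sup>2) \<le> (C1 + C2) * exp (- (\<beta> * x))"
    using assms by (intro mult_left_mono) auto
  finally show ?thesis .
qed

text \<open>At level \<open>x\<close> the process runs for a time proportional to \<open>x\<close>. Three things may go wrong: a large
  initial velocity, which is excluded by \<open>V_tail_le\<close>, upward increments of \<open>B\<close>, which would make the velocity large
  later on, and downward increments of \<open>B\<close>, which push \<open>H\<close> up directly. The first two have Gaussian
  probabilities in \<open>x\<close>; the third has probability of order \<open>exp (- g x / (8 \<gamma>))\<close>.\<close>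

lemma H_tail_le:
  fixes \<gamma> g :: real
  assumes \<gamma>: "0 < \<gamma>" and g: "0 < g"
  shows "\<exists>K>0. \<exists>x0>0. \<forall>\<pi>. inert_drift_stationary \<gamma> g \<pi> \<longrightarrow> (\<forall>x\<ge>x0.
    measure \<pi> ({x<..} \<times> UNIV) \<le> K * exp (- (g / (32 * \<gamma>) * x)))"
proof -
  obtain KV where KV: "0 < KV" and V_tail: "\<And>\<pi> u. inert_drift_stationary \<gamma> g \<pi> \<Longrightarrow> 1 \<le> u \<Longrightarrow>
      measure \<pi> ({0..} \<times> {u - g / (1 + \<gamma>)<..}) \<le> KV * exp (- ((1 + \<gamma>) / 8 * u\<^sup>2))"
    using V_tail_le[OF assms] by blast
  \<comment> \<open>The Gaussian exponent \<open>(1 + \<gamma>) u\<^sup>2 / 8\<close> at \<open>u = \<gamma> x / 6\<close> equals \<open>\<alpha> x\<^sup>2\<close>.\<close>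
  define \<alpha> where "\<alpha> = (1 + \<gamma>) * \<gamma>\<^sup>2 / 288"
  define \<beta> where "\<beta> = g / (32 * \<gamma>)"
  \<comment> \<open>The number of cells needed for the upward increments is about \<open>D x\<close>.\<close>
  define D where "D = 256 * (1 + \<gamma>) * \<gamma> / g"
  have pos: "0 < \<alpha>" "0 < \<beta>" "0 < D" using \<gamma> g by (auto simp: \<alpha>_def \<beta>_def D_def)
  \<comment> \<open>One summand for each lower bound on the level that the argument requires.\<close>
  define x0 where "x0 = 1 + 4 * g / \<gamma>\<^sup>2 + 6 / \<gamma> + (1 + \<beta>) / \<alpha>"
  have "0 \<le> 4 * g / \<gamma>\<^sup>2" "0 \<le> 6 / \<gamma>" "0 \<le> (1 + \<beta>) / \<alpha>" using pos g \<gamma> by auto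
  then have x0: "1 \<le> x0" "4 * g / \<gamma>\<^sup>2 \<le> x0" "6 / \<gamma> \<le> x0" "(1 + \<beta>) / \<alpha> \<le> x0"
    unfolding x0_def by linarith+
  define K1 where "K1 = KV + 2 + 2 * D + 2048"
  have K1: "0 < K1" using KV pos by (simp add: K1_def)
  have step: "measure \<pi> ({x<..} \<times> UNIV) \<le> measure \<pi> ({2 * x<..} \<times> UNIV) + K1 * exp (- (\<beta> * x))"
    if st: "inert_drift_stationary \<gamma> g \<pi>" and x: "x0 \<le> x" for \<pi> x
  proof -
    interpret P: prob_space \<pi> using st by (simp add: inert_drift_stationary_def)
    have sets: "sets \<pi> = sets borel" using st by (simp add: inert_drift_stationary_def)
    have xpos: "0 < x" using x x0 by linarith
    define u where "u = \<gamma> * x / 6"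
    define T where "T = 4 * \<gamma> * x / g"
    define n where "n = nat \<lceil>D * x\<rceil>"
    have T: "0 < T" unfolding T_def using \<gamma> g xpos by simp
    have "6 / \<gamma> \<le> x" using x0 x by linarith
    then have u: "1 \<le> u" unfolding u_def using \<gamma> by (simp add: divide_le_eq mult.commute)
    have "0 \<le> D * x" using pos xpos by simp
    then have n: "D * x \<le> real n" "real n \<le> D * x + 1" unfolding n_def by linarith+
    have au: "(1 + \<gamma>) / 8 * u\<^sup>2 = \<alpha> * x\<^sup>2" by (simp add: u_def \<alpha>_def power2_eq_square)
    let ?A' = "({2 * x<..} \<times> UNIV) \<union> ({0..} \<times> {u - g / (1 + \<gamma>)<..})"
    let ?p = "2 * real n * exp (- (\<alpha> * x\<^sup>2)) + 2048 * exp (- (\<beta> * x))"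
    have "measure \<pi> ({x<..} \<times> UNIV) \<le> measure \<pi> ?A' + ?p"
    proof (rule stationary_measure_le[OF st measurable_tail_sets(2) _ less_imp_le[OF T]])
      show "?A' \<in> sets borel" by (intro sets.Un measurable_tail_sets)
      fix M :: "(real \<Rightarrow> real) measure" and B assume "brownian_motion M B"
      then interpret brownian_motion M B .
      have "\<exists>N\<in>events. prob N \<le> 2 * real n * exp (- ((1 + \<gamma>) * u / 4 * (u / 2))) \<and>
        (AE \<omega> in M. \<omega> \<notin> N \<longrightarrow> (\<forall>r s. 0 \<le> r \<longrightarrow> r \<le> s \<longrightarrow> s \<le> T \<longrightarrow>
          1 * (B s \<omega> - B r \<omega>) \<le> u / 2 + (1 + \<gamma>) * u / 4 * (s - r)))"
      proof (rule increments_bound)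
        have "64 * (1 + \<gamma>) * T = D * x" using g by (simp add: T_def D_def)
        then have "64 * (1 + \<gamma>) * T * (u / 2) \<le> real n * (u / 2)" using n u by (intro mult_right_mono) auto
        moreover have "128 * ((1 + \<gamma>) * u / 4) * T = 64 * (1 + \<gamma>) * T * (u / 2)" by simp
        ultimately show "128 * ((1 + \<gamma>) * u / 4) * T \<le> real n * (u / 2)" by (simp only:)
      qed (use u \<gamma> T in auto)
      moreover have "(1 + \<gamma>) * u / 4 * (u / 2) = \<alpha> * x\<^sup>2"
        unfolding au[symmetric] by (simp add: power2_eq_square)
      ultimately obtain N1 where N1: "N1 \<in> events" "prob N1 \<le> 2 * real n * exp (- (\<alpha> * x\<^sup>2))"
        and inc: "AE \<omega> in M. \<omega> \<notin> N1 \<longrightarrow> (\<forall>r s. 0 \<le> r \<longrightarrow> r \<le> s \<longrightarrow> s \<le> T \<longrightarrow>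
          B s \<omega> - B r \<omega> \<le> u / 2 + (1 + \<gamma>) * u / 4 * (s - r))"
        by (auto simp only: mult_1)
      have "\<exists>N\<in>events. prob N \<le> 2 * real 1024 * exp (- (g / (2 * \<gamma>) * (x / 4))) \<and>
        (AE \<omega> in M. \<omega> \<notin> N \<longrightarrow> (\<forall>r s. 0 \<le> r \<longrightarrow> r \<le> s \<longrightarrow> s \<le> T \<longrightarrow>
          - 1 * (B s \<omega> - B r \<omega>) \<le> x / 4 + g / (2 * \<gamma>) * (s - r)))"
      proof (rule increments_bound)
        show "128 * (g / (2 * \<gamma>)) * T \<le> real 1024 * (x / 4)" using g \<gamma> by (simp add: T_def)
      qed (use xpos g \<gamma> T in auto)
      then obtain N2 where N2: "N2 \<in> events" "prob N2 \<le> 2048 * exp (- (g / (2 * \<gamma>) * (x / 4)))"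
        and dec: "AE \<omega> in M. \<omega> \<notin> N2 \<longrightarrow> (\<forall>r s. 0 \<le> r \<longrightarrow> r \<le> s \<longrightarrow> s \<le> T \<longrightarrow>
          - (B s \<omega> - B r \<omega>) \<le> x / 4 + g / (2 * \<gamma>) * (s - r))"
        by auto
      have "\<beta> * x \<le> 4 * (\<beta> * x)" using pos xpos by simp
      also have "4 * (\<beta> * x) = g / (2 * \<gamma>) * (x / 4)" by (simp add: \<beta>_def)
      finally have "exp (- (g / (2 * \<gamma>) * (x / 4))) \<le> exp (- (\<beta> * x))" by simp
      then have "prob (N1 \<union> N2) \<le> ?p"
        using measure_Un_le[OF N1(1) N2(1)] N1(2) N2(2) by linarith
      moreover have H_le: "H T \<le> x"
        if path: "inert_drift_path \<gamma> g (h, v) (\<lambda>t. B t \<omega>) H V L"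
          and inc: "\<forall>r s. 0 \<le> r \<longrightarrow> r \<le> s \<longrightarrow> s \<le> T \<longrightarrow> B s \<omega> - B r \<omega> \<le> u / 2 + (1 + \<gamma>) * u / 4 * (s - r)"
          and dec: "\<forall>r s. 0 \<le> r \<longrightarrow> r \<le> s \<longrightarrow> s \<le> T \<longrightarrow> - (B s \<omega> - B r \<omega>) \<le> x / 4 + g / (2 * \<gamma>) * (s - r)"
          and z: "(h, v) \<notin> ?A'" for \<omega> h v H V L
      proof -
        interpret inert_path \<gamma> g h v "\<lambda>t. B t \<omega>" H V L using \<gamma> g path by unfold_locales
        have "0 \<le> h" using H_nonneg[OF order_refl] H_0 by simp
        then have hv: "v + g / (1 + \<gamma>) \<le> u" "h \<le> 2 * x" using z by auto
        have "4 * g / \<gamma>\<^sup>2 \<le> x" using x0 x by linarith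
        from xpos this T_def u_def _ _ hv show ?thesis
          by (rule H_le_level) (use inc dec in blast)+
      qed
      ultimately show "\<exists>N\<in>events. prob N \<le> ?p \<and>
        (AE \<omega> in M. \<omega> \<notin> N \<longrightarrow> (\<forall>h v H V L. inert_drift_path \<gamma> g (h, v) (\<lambda>t. B t \<omega>) H V L \<longrightarrow>
          (h, v) \<notin> ?A' \<longrightarrow> (H T, V T) \<notin> {x<..} \<times> UNIV))"
      proof (intro bexI[of _ "N1 \<union> N2"] conjI)
        show "AE \<omega> in M. \<omega> \<notin> N1 \<union> N2 \<longrightarrow>
          (\<forall>h v H V L. inert_drift_path \<gamma> g (h, v) (\<lambda>t. B t \<omega>) H V L \<longrightarrow>
            (h, v) \<notin> ?A' \<longrightarrow> (H T, V T) \<notin> {x<..} \<times> UNIV)"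
          using inc dec
        proof eventually_elim
          case (elim \<omega>)
          show ?case
          proof (intro impI allI)
            fix h v H V L
            assume "\<omega> \<notin> N1 \<union> N2" "inert_drift_path \<gamma> g (h, v) (\<lambda>t. B t \<omega>) H V L" "(h, v) \<notin> ?A'"
            then have "H T \<le> x" using elim by (intro H_le[of h v \<omega> H V L]) auto
            then show "(H T, V T) \<notin> {x<..} \<times> UNIV" by simp
          qed
        qed
      qed (use N1(1) N2(1) in auto)
    qed simp
    also have "measure \<pi> ?A' \<le> measure \<pi> ({2 * x<..} \<times> UNIV) + KV * exp (- (\<alpha> * x\<^sup>2))"
      using measure_Un_le[of "{2 * x<..} \<times> UNIV" \<pi> "{0..} \<times> {u - g / (1 + \<gamma>)<..}"]
        V_tail[OF st u] measurable_tail_sets unfolding sets au by fastforce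
    finally have "measure \<pi> ({x<..} \<times> UNIV) \<le> measure \<pi> ({2 * x<..} \<times> UNIV) +
        (KV + 2 * real n) * exp (- (\<alpha> * x\<^sup>2)) + 2048 * exp (- (\<beta> * x))"
      by (simp add: distrib_right)
    moreover have "(KV + 2 * real n) * exp (- (\<alpha> * x\<^sup>2)) \<le> ((KV + 2) + (2 * D) * x) * exp (- (\<alpha> * x\<^sup>2))"
      using n by (intro mult_right_mono) auto
    moreover have "((KV + 2) + (2 * D) * x) * exp (- (\<alpha> * x\<^sup>2)) \<le> ((KV + 2) + 2 * D) * exp (- (\<beta> * x))"
      using pos KV xpos x0 x by (intro linear_times_gaussian_le) auto
    moreover have "K1 * exp (- (\<beta> * x)) = ((KV + 2) + 2 * D) * exp (- (\<beta> * x)) + 2048 * exp (- (\<beta> * x))"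
      by (simp add: K1_def distrib_right)
    ultimately show ?thesis by linarith
  qed
  let ?K = "K1 / (1 - exp (- (\<beta> * x0 ^ 1)))"
  have "measure \<pi> ({x<..} \<times> UNIV) \<le> ?K * exp (- (\<beta> * x ^ 1))"
    if st: "inert_drift_stationary \<gamma> g \<pi>" and x: "x0 \<le> x" for \<pi> x
  proof (rule doubling_bound[where F = "\<lambda>x. measure \<pi> ({x<..} \<times> UNIV)", OF _ _ _ _ _ _ x])
    interpret P: prob_space \<pi> using st by (simp add: inert_drift_stationary_def)
    have sets: "sets \<pi> = sets borel" using st by (simp add: inert_drift_stationary_def)
    show "((\<lambda>x. measure \<pi> ({x<..} \<times> UNIV)) \<longlongrightarrow> 0) at_top"
    proof (rule P.tendsto_measure_tail)
      show "(\<Inter>n. {real n<..} \<times> UNIV) = ({} :: (real \<times> real) set)"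
      proof safe
        fix h v :: real assume "(h, v) \<in> (\<Inter>n. {real n<..} \<times> UNIV)"
        then have "real n < h" for n by auto
        then show "(h, v) \<in> {}" using reals_Archimedean2[of h] less_asym by blast
      qed
    qed (use sets measurable_tail_sets in auto)
  qed (use step[OF st] x0 pos K1 in auto)
  moreover have "0 < ?K" using K1 pos x0 by (intro divide_pos_pos) auto
  moreover have "0 < x0" using x0 by linarith
  ultimately show ?thesis unfolding \<beta>_def power_one_right by blast
qed

lemma stationary_tail_ge:
  fixes A K :: "(real \<times> real) set"
  assumes st: "inert_drift_stationary \<gamma> g \<pi>"
    and A: "A \<in> sets borel" and K: "K \<in> sets borel" and T: "0 < T" and z: "0 \<le> z"
    and c: "c\<^sup>2 = 1"
    and step: "\<And>h v b H V L. inert_drift_path \<gamma> g (h, v) b H V L \<Longrightarrow> (h, v) \<in> K \<Longrightarrow>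
      z < c * (b T - b 0) \<Longrightarrow> (H T, V T) \<in> A"
  shows "measure \<pi> K * (exp (- ((z + 1)\<^sup>2 / (2 * T))) / sqrt (2 * pi * T)) \<le> measure \<pi> A"
proof (rule stationary_measure_ge[OF st A K less_imp_le[OF T]])
  fix M :: "(real \<Rightarrow> real) measure" and B assume "brownian_motion M B"
  then interpret brownian_motion M B .
  have [measurable]: "B T \<in> borel_measurable M" "B 0 \<in> borel_measurable M"
    using T by (auto intro: measurable_B)
  show "\<exists>E\<in>events. ennreal (exp (- ((z + 1)\<^sup>2 / (2 * T))) / sqrt (2 * pi * T)) \<le> emeasure M E \<and>
    (\<forall>\<omega>\<in>E. \<forall>h v H V L. inert_drift_path \<gamma> g (h, v) (\<lambda>t. B t \<omega>) H V L \<longrightarrow> (h, v) \<in> K \<longrightarrow> (H T, V T) \<in> A)"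
    using tail_ge[OF c T z] step
    by (intro bexI[of _ "{\<omega> \<in> space M. z < c * (B T \<omega> - B 0 \<omega>)}"] conjI) (assumption, blast, measurable)
qed (use T in simp)

text \<open>With \<open>T = x \<gamma> / g\<close> the drift costs at most \<open>x\<close>, so it suffices that \<open>B\<close> drops by \<open>2 x\<close>; the exponent is
  \<open>(2 x)\<^sup>2 / (2 T) = 2 g x / \<gamma>\<close>, and the slack up to \<open>4 g x / \<gamma>\<close> absorbs the factor \<open>1 / sqrt T\<close> of
  the normal density.\<close>

lemma H_tail_ge:
  fixes \<gamma> g :: real
  assumes \<gamma>: "0 < \<gamma>" and g: "0 < g"
  shows "\<exists>C>0. \<forall>\<pi>. inert_drift_stationary \<gamma> g \<pi> \<longrightarrow> (\<forall>x\<ge>1.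
    exp (- C) * exp (- (4 * g * x / \<gamma>)) \<le> measure \<pi> ({x<..} \<times> UNIV))"
proof -
  \<comment> \<open>Chosen such that \<open>2 pi T = (D - 1) w\<close> for \<open>w = g x / \<gamma>\<close>.\<close>
  define D where "D = 1 + 2 * pi * \<gamma>\<^sup>2 / g\<^sup>2"
  have "0 < 2 * pi * \<gamma>\<^sup>2 / g\<^sup>2" using \<gamma> g by simp
  then have D: "1 < D" by (simp add: D_def)
  define C where "C = 5 * g / (2 * \<gamma>) + ln D"
  have C: "0 < C" using D g \<gamma> by (simp add: C_def add_pos_pos)
  have "exp (- C) * exp (- (4 * g * x / \<gamma>)) \<le> measure \<pi> ({x<..} \<times> UNIV)"
    if st: "inert_drift_stationary \<gamma> g \<pi>" and x: "1 \<le> x" for \<pi> x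
  proof -
    interpret P: prob_space \<pi> using st by (simp add: inert_drift_stationary_def)
    have sets: "sets \<pi> = sets borel" using st by (simp add: inert_drift_stationary_def)
    define T where "T = x * \<gamma> / g"
    have T: "0 < T" using x \<gamma> g by (simp add: T_def)
    have "measure \<pi> UNIV * (exp (- ((2 * x + 1)\<^sup>2 / (2 * T))) / sqrt (2 * pi * T)) \<le>
        measure \<pi> ({x<..} \<times> UNIV)"
    proof (rule stationary_tail_ge[OF st measurable_tail_sets(2) _ T, where c = "- 1"])
      fix h v b H V L
      assume path: "inert_drift_path \<gamma> g (h, v) b H V L" and "2 * x < - 1 * (b T - b 0)"
      moreover interpret inert_path \<gamma> g h v b H V L using \<gamma> g path by unfold_locales
      have "g / \<gamma> * T = x" using \<gamma> g by (simp add: T_def)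
      then have "- x - (b T - b 0) \<le> H T" using H_ge[OF less_imp_le[OF T]] by simp
      ultimately show "(H T, V T) \<in> {x<..} \<times> UNIV" by simp
    qed (use x in auto)
    moreover have "measure \<pi> UNIV = 1"
      using P.prob_space sets_eq_imp_space_eq[OF sets] by simp
    moreover have "exp (- C) * exp (- (4 * g * x / \<gamma>)) \<le> exp (- ((2 * x + 1)\<^sup>2 / (2 * T))) / sqrt (2 * pi * T)"
    proof -
      define w where "w = g * x / \<gamma>"
      have w: "0 < w" using x \<gamma> g by (simp add: w_def)
      have "(2 * x + 1)\<^sup>2 \<le> x * (4 * x + 5)"
        using x by (simp add: power2_eq_square algebra_simps)
      then have "(2 * x + 1)\<^sup>2 / (2 * T) \<le> x * (4 * x + 5) / (2 * T)"
        using T by (intro divide_right_mono) auto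
      also have "\<dots> = 2 * w + 5 * g / (2 * \<gamma>)"
        using x \<gamma> g by (simp add: T_def w_def field_simps)
      finally have e1: "exp (- (2 * w + 5 * g / (2 * \<gamma>))) \<le> exp (- ((2 * x + 1)\<^sup>2 / (2 * T)))" by simp
      have "sqrt (2 * pi * T) \<le> sqrt ((1 + 2 * pi * T)\<^sup>2)"
      proof (rule real_sqrt_le_mono)
        have "q \<le> (1 + q)\<^sup>2" if "0 \<le> q" for q :: real
          using that by (simp add: power2_eq_square algebra_simps)
        then show "2 * pi * T \<le> (1 + 2 * pi * T)\<^sup>2" using T by simp
      qed
      also have "\<dots> = 1 + (D - 1) * w" using T x \<gamma> g by (simp add: D_def w_def T_def power2_eq_square)
      also have "\<dots> \<le> 1 * exp w + (D - 1) * exp w"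
      proof -
        have "1 \<le> exp w" "w \<le> exp w" using w exp_ge_add_one_self[of w] by linarith+
        then show ?thesis using D by (intro add_mono mult_left_mono) auto
      qed
      also have "\<dots> = D * exp w" by (simp add: algebra_simps)
      finally have e2: "sqrt (2 * pi * T) \<le> D * exp w" .
      have "exp (- C) * exp (- (4 * w)) \<le> exp (- (5 * g / (2 * \<gamma>))) / D * exp (- (3 * w))"
        using w D by (auto simp: C_def exp_add exp_diff exp_minus field_simps intro!: mult_mono)
      also have "\<dots> = exp (- (2 * w + 5 * g / (2 * \<gamma>))) / (D * exp w)"
      proof -
        have "exp (- r) * exp (- (3 * w)) = exp (- (2 * w + r)) * exp (- w)" for r
          unfolding exp_add[symmetric] by (rule arg_cong[where f = exp]) simp
        then have "exp (- r) / D * exp (- (3 * w)) = exp (- (2 * w + r)) / (D * exp w)" for r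
          by (simp add: exp_minus[of w] divide_inverse mult.commute mult.left_commute)
        then show ?thesis .
      qed
      also have "\<dots> \<le> exp (- ((2 * x + 1)\<^sup>2 / (2 * T))) / sqrt (2 * pi * T)"
        using e1 e2 T D by (intro frac_le) auto
      finally show ?thesis by (simp add: w_def mult.assoc)
    qed
    ultimately show ?thesis by simp
  qed
  with C show ?thesis by blast
qed

text \<open>By convexity the graph lies below its chord over \<open>[0, 1]\<close>, whose slope is \<open>e - 1 < 7/4\<close>. The
  slope matters: the lower bound for \<open>V\<close> has exponent \<open>(1 + 7/4)\<^sup>2 / 2 < 4\<close> in units of \<open>(1 + \<gamma>) y\<^sup>2\<close>.\<close>

lemma exp_chord_le:
  fixes k :: real
  assumes "0 \<le> k" "k \<le> 1" shows "exp k - 1 \<le> 7 / 4 * k"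
proof -
  have "exp ((1 - k) *\<^sub>R 0 + k *\<^sub>R 1) \<le> (1 - k) * exp 0 + k * exp (1 :: real)"
    using assms by (intro convex_onD[OF exp_convex]) auto
  moreover have "k * exp 1 \<le> k * (272 / 100)"
    using assms e_less_272 by (intro mult_left_mono) auto
  ultimately show ?thesis using assms by simp
qed

text \<open>\<open>R\<close> is chosen such that \<open>H \<le> R\<close> has probability at least \<open>1/2\<close> under every stationary law. From
  such a starting point \<open>V_gt_level\<close> with \<open>T = 1 / (1 + \<gamma>)\<close> requires an increment \<open>z = 11/4 y + const\<close> of
  \<open>B\<close>.\<close>

lemma V_tail_ge:
  fixes \<gamma> g :: real
  assumes \<gamma>: "0 < \<gamma>" and g: "0 < g"
  shows "\<exists>C>0. \<forall>\<pi>. inert_drift_stationary \<gamma> g \<pi> \<longrightarrow> (\<forall>y\<ge>0.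
    exp (- C) * exp (- (4 * (1 + \<gamma>) * (y + g / (1 + \<gamma>))\<^sup>2)) \<le> measure \<pi> ({0..} \<times> {y<..}))"
proof -
  obtain K x0 where K: "0 < K" and x0: "0 < x0"
    and H_tail: "\<And>\<pi> x. inert_drift_stationary \<gamma> g \<pi> \<Longrightarrow> x0 \<le> x \<Longrightarrow>
      measure \<pi> ({x<..} \<times> UNIV) \<le> K * exp (- (g / (32 * \<gamma>) * x))"
    using H_tail_le[OF assms] by blast
  define R where "R = max x0 (32 * \<gamma> / g * ln (2 * K))"
  have R: "x0 \<le> R" "0 \<le> R" using x0 by (auto simp: R_def)
  have KR: "K * exp (- (g / (32 * \<gamma>) * R)) \<le> 1 / 2"
  proof -
    have "32 * \<gamma> / g * ln (2 * K) \<le> R" by (simp add: R_def)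
    then have "g / (32 * \<gamma>) * (32 * \<gamma> / g * ln (2 * K)) \<le> g / (32 * \<gamma>) * R"
      using g \<gamma> by (intro mult_left_mono) auto
    then have "ln (2 * K) \<le> g / (32 * \<gamma>) * R" using g \<gamma> by simp
    then have "exp (- (g / (32 * \<gamma>) * R)) \<le> exp (- ln (2 * K))" by simp
    also have "\<dots> = 1 / (2 * K)" using K by (simp add: exp_minus inverse_eq_divide)
    finally have "K * exp (- (g / (32 * \<gamma>) * R)) \<le> K * (1 / (2 * K))"
      using K by (intro mult_left_mono) auto
    then show ?thesis using K by simp
  qed
  define T where "T = 1 / (1 + \<gamma>)"
  \<comment> \<open>\<open>D\<close> collects the terms of \<open>z + 1\<close> that do not depend on \<open>y\<close>.\<close>
  define D where "D = R + 1 + 11 / 4 * (g / \<gamma>)"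
  define C where "C = (1 + \<gamma>) / 2 * (19 * D\<^sup>2) + ln (1 + 2 * sqrt (2 * pi * T))"
  have T: "0 < T" using \<gamma> by (simp add: T_def)
  have "0 \<le> (1 + \<gamma>) / 2 * (19 * D\<^sup>2)" using \<gamma> by simp
  moreover have "0 < ln (1 + 2 * sqrt (2 * pi * T))" using T by (intro ln_gt_zero) simp
  ultimately have C: "0 < C" by (simp add: C_def)
  have "exp (- C) * exp (- (4 * (1 + \<gamma>) * (y + g / (1 + \<gamma>))\<^sup>2)) \<le> measure \<pi> ({0..} \<times> {y<..})"
    if st: "inert_drift_stationary \<gamma> g \<pi>" and y: "0 \<le> y" for \<pi> y
  proof -
    interpret P: prob_space \<pi> using st by (simp add: inert_drift_stationary_def)
    have sets: "sets \<pi> = sets borel" using st by (simp add: inert_drift_stationary_def)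
    have space: "space \<pi> = UNIV" using sets_eq_imp_space_eq[OF sets] by simp
    have gg: "0 < g / \<gamma>" using \<gamma> g by simp
    let ?K = "{..R} \<times> (UNIV :: real set)"
    have "?K = UNIV - {R<..} \<times> UNIV" by auto
    then have "measure \<pi> ?K = 1 - measure \<pi> ({R<..} \<times> UNIV)"
      using P.prob_compl[of "{R<..} \<times> UNIV"] measurable_tail_sets(2) sets space by simp
    then have half: "1 / 2 \<le> measure \<pi> ?K" using H_tail[OF st R(1)] KR by linarith
    define z where "z = 11 / 4 * y + D - 1"
    have z: "0 \<le> z" using y R gg by (simp add: z_def D_def)
    have "measure \<pi> ?K * (exp (- ((z + 1)\<^sup>2 / (2 * T))) / sqrt (2 * pi * T)) \<le> measure \<pi> ({0..} \<times> {y<..})"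
    proof (rule stationary_tail_ge[OF st measurable_tail_sets(1) _ T z, where c = 1])
      show "?K \<in> sets borel" by (intro borel_Times) auto
      fix h v b H V L
      assume path: "inert_drift_path \<gamma> g (h, v) b H V L" and h: "(h, v) \<in> ?K" and inc: "z < 1 * (b T - b 0)"
      interpret inert_path \<gamma> g h v b H V L using \<gamma> g path by unfold_locales
      have "y < V T"
      proof (rule V_gt_level[OF less_imp_le[OF T]])
        show "h \<le> R" using h by simp
        have "\<gamma> * T \<le> 1" "0 \<le> \<gamma> * T" using \<gamma> by (simp_all add: T_def)
        then have "(exp (\<gamma> * T) - 1) / \<gamma> \<le> 7 / 4 * (\<gamma> * T) / \<gamma>"
          using \<gamma> by (intro divide_right_mono exp_chord_le) auto
        also have "\<dots> = 7 / 4 * T" using \<gamma> by simp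
        finally have "(1 + \<gamma>) * ((exp (\<gamma> * T) - 1) / \<gamma>) \<le> (1 + \<gamma>) * (7 / 4 * T)"
          using \<gamma> by (intro mult_left_mono) auto
        also have "\<dots> = 7 / 4 * ((1 + \<gamma>) * T)" by simp
        also have "(1 + \<gamma>) * T = 1" using \<gamma> by (simp add: T_def)
        finally have "(1 + \<gamma>) * ((exp (\<gamma> * T) - 1) / \<gamma>) \<le> 7 / 4" by simp
        then have "(1 + \<gamma>) * ((exp (\<gamma> * T) - 1) / \<gamma>) * (y + g / \<gamma>) \<le> 7 / 4 * (y + g / \<gamma>)"
          using y gg by (intro mult_right_mono) auto
        then have "y + R + g / \<gamma> + (1 + \<gamma>) * ((exp (\<gamma> * T) - 1) / \<gamma>) * (y + g / \<gamma>) \<le>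
            y + R + g / \<gamma> + 7 / 4 * (y + g / \<gamma>)" by (rule add_left_mono)
        also have "\<dots> = z"
        proof -
          have "y + R + q + 7 / 4 * (y + q) = 11 / 4 * y + (R + 1 + 11 / 4 * q) - 1" for q
            by (simp add: field_simps)
          then show ?thesis unfolding z_def D_def .
        qed
        also have "z < b T - b 0" using inc by simp
        finally show "y + R + g / \<gamma> + (1 + \<gamma>) * ((exp (\<gamma> * T) - 1) / \<gamma>) * (y + g / \<gamma>) < b T - b 0" .
      qed
      then show "(H T, V T) \<in> {0..} \<times> {y<..}" using H_nonneg[of T] T by simp
    qed simp
    moreover have "1 / 2 * (exp (- ((z + 1)\<^sup>2 / (2 * T))) / sqrt (2 * pi * T)) \<le>
        measure \<pi> ?K * (exp (- ((z + 1)\<^sup>2 / (2 * T))) / sqrt (2 * pi * T))"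
      using half T by (intro mult_right_mono) auto
    moreover have "exp (- C) * exp (- (4 * (1 + \<gamma>) * (y + g / (1 + \<gamma>))\<^sup>2)) \<le>
        1 / 2 * (exp (- ((z + 1)\<^sup>2 / (2 * T))) / sqrt (2 * pi * T))"
    proof -
      \<comment> \<open>Completing the square in \<open>8 y\<^sup>2 + 19 D\<^sup>2 - (11/4 y + D)\<^sup>2\<close>.\<close>
      have "0 \<le> 7 / 16 * (y - 44 / 7 * D)\<^sup>2 + 5 / 7 * D\<^sup>2" by simp
      then have "(z + 1)\<^sup>2 \<le> 8 * y\<^sup>2 + 19 * D\<^sup>2"
        by (simp add: z_def power2_eq_square algebra_simps)
      then have "(1 + \<gamma>) / 2 * (z + 1)\<^sup>2 \<le> (1 + \<gamma>) / 2 * (8 * y\<^sup>2 + 19 * D\<^sup>2)"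
        using \<gamma> by (intro mult_left_mono) auto
      moreover have "(z + 1)\<^sup>2 / (2 * T) = (1 + \<gamma>) / 2 * (z + 1)\<^sup>2" by (simp add: T_def)
      moreover have "(1 + \<gamma>) / 2 * (8 * y\<^sup>2 + 19 * D\<^sup>2) = 4 * (1 + \<gamma>) * y\<^sup>2 + (1 + \<gamma>) / 2 * (19 * D\<^sup>2)"
        by (simp add: field_simps)
      moreover have "4 * (1 + \<gamma>) * y\<^sup>2 \<le> 4 * (1 + \<gamma>) * (y + g / (1 + \<gamma>))\<^sup>2"
        using y \<gamma> g by (intro mult_left_mono power_mono) auto
      ultimately have "- (4 * (1 + \<gamma>) * (y + g / (1 + \<gamma>))\<^sup>2) - (1 + \<gamma>) / 2 * (19 * D\<^sup>2)
          \<le> - ((z + 1)\<^sup>2 / (2 * T))"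
        by argo
      then have e: "exp (- (4 * (1 + \<gamma>) * (y + g / (1 + \<gamma>))\<^sup>2) - (1 + \<gamma>) / 2 * (19 * D\<^sup>2))
          \<le> exp (- ((z + 1)\<^sup>2 / (2 * T)))" by simp
      have s: "0 < sqrt (2 * pi * T)" using T by simp
      have "exp (- (p + ln q)) * exp (- r) = exp (- r - p) / q" if "0 < q" for p q r :: real
      proof -
        have "exp (- (p + ln q)) * exp (- r) = exp ((- r - p) - ln q)"
          unfolding exp_add[symmetric] by (rule arg_cong[where f = exp]) simp
        also have "\<dots> = exp (- r - p) / q" using that by (simp only: exp_diff[of _ "ln q"] exp_ln)
        finally show ?thesis .
      qed
      note split = this
      have "exp (- C) * exp (- (4 * (1 + \<gamma>) * (y + g / (1 + \<gamma>))\<^sup>2)) =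
          exp (- (4 * (1 + \<gamma>) * (y + g / (1 + \<gamma>))\<^sup>2) - (1 + \<gamma>) / 2 * (19 * D\<^sup>2)) / (1 + 2 * sqrt (2 * pi * T))"
        unfolding C_def by (rule split) (use s in linarith)
      also have "\<dots> \<le> exp (- ((z + 1)\<^sup>2 / (2 * T))) / (2 * sqrt (2 * pi * T))"
        using e s by (intro frac_le) auto
      finally show ?thesis by simp
    qed
    ultimately show ?thesis by linarith
  qed
  with C show ?thesis by blast
qed

lemma le_exp_ln_2_add:
  fixes K :: real
  assumes "0 < K" shows "0 < ln (2 + K)" "K \<le> exp (ln (2 + K))"
  using assms by simp_all

theorem theorem1p3:
  fixes \<gamma> g :: real
  assumes "\<gamma> > 0" and "g > 0"
  shows "(\<exists>y' c' c :: real. y' > 0 \<and> c' > 0 \<and> c > 0 \<and>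
            (\<forall>\<pi>. inert_drift_stationary \<gamma> g \<pi> \<longrightarrow> (\<forall>y>y'.
               exp (- c') * exp (- (4 * (1 + \<gamma>) * (y + g / (1 + \<gamma>))\<^sup>2))
                 \<le> measure \<pi> ({0..} \<times> {y<..}) \<and>
               measure \<pi> ({0..} \<times> {y<..})
                 \<le> exp c * exp (- ((1 + \<gamma>) / 8 * (y + g / (1 + \<gamma>))\<^sup>2))))) \<and>
         (\<exists>x' C' C :: real. x' > 0 \<and> C' > 0 \<and> C > 0 \<and>
            (\<forall>\<pi>. inert_drift_stationary \<gamma> g \<pi> \<longrightarrow> (\<forall>x>x'.
               exp (- C') * exp (- (4 * g * x / \<gamma>)) \<le> measure \<pi> ({x<..} \<times> UNIV) \<and>
               measure \<pi> ({x<..} \<times> UNIV) \<le> exp C * exp (- (g * x / (32 * \<gamma>))))))"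
proof (rule conjI)
  obtain K where K: "0 < K" and upper: "\<And>\<pi> u. inert_drift_stationary \<gamma> g \<pi> \<Longrightarrow> 1 \<le> u \<Longrightarrow>
      measure \<pi> ({0..} \<times> {u - g / (1 + \<gamma>)<..}) \<le> K * exp (- ((1 + \<gamma>) / 8 * u\<^sup>2))"
    using V_tail_le[OF assms] by blast
  obtain c' where c': "0 < c'" and lower: "\<And>\<pi> y. inert_drift_stationary \<gamma> g \<pi> \<Longrightarrow> 0 \<le> y \<Longrightarrow>
      exp (- c') * exp (- (4 * (1 + \<gamma>) * (y + g / (1 + \<gamma>))\<^sup>2)) \<le> measure \<pi> ({0..} \<times> {y<..})"
    using V_tail_ge[OF assms] by blast
  have up: "measure \<pi> ({0..} \<times> {y<..}) \<le> exp (ln (2 + K)) * exp (- ((1 + \<gamma>) / 8 * (y + g / (1 + \<gamma>))\<^sup>2))"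
    if st: "inert_drift_stationary \<gamma> g \<pi>" and y: "1 < y" for \<pi> y
  proof -
    have "0 < g / (1 + \<gamma>)" using assms by simp
    then have "1 \<le> y + g / (1 + \<gamma>)" using y by linarith
    from upper[OF st this]
    have "measure \<pi> ({0..} \<times> {y<..}) \<le> K * exp (- ((1 + \<gamma>) / 8 * (y + g / (1 + \<gamma>))\<^sup>2))" by simp
    also have "\<dots> \<le> exp (ln (2 + K)) * exp (- ((1 + \<gamma>) / 8 * (y + g / (1 + \<gamma>))\<^sup>2))"
      by (intro mult_right_mono le_exp_ln_2_add K) simp
    finally show ?thesis .
  qed
  have low: "exp (- c') * exp (- (4 * (1 + \<gamma>) * (y + g / (1 + \<gamma>))\<^sup>2)) \<le> measure \<pi> ({0..} \<times> {y<..})"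
    if "inert_drift_stationary \<gamma> g \<pi>" "1 < y" for \<pi> y
    using that by (intro lower) auto
  show "\<exists>y' c' c :: real. y' > 0 \<and> c' > 0 \<and> c > 0 \<and>
      (\<forall>\<pi>. inert_drift_stationary \<gamma> g \<pi> \<longrightarrow> (\<forall>y>y'.
         exp (- c') * exp (- (4 * (1 + \<gamma>) * (y + g / (1 + \<gamma>))\<^sup>2)) \<le> measure \<pi> ({0..} \<times> {y<..}) \<and>
         measure \<pi> ({0..} \<times> {y<..}) \<le> exp c * exp (- ((1 + \<gamma>) / 8 * (y + g / (1 + \<gamma>))\<^sup>2))))"
    using zero_less_one c' le_exp_ln_2_add(1)[OF K] up low by blast
next
  obtain K x0 where K: "0 < K" and x0: "0 < x0"
    and upper: "\<And>\<pi> x. inert_drift_stationary \<gamma> g \<pi> \<Longrightarrow> x0 \<le> x \<Longrightarrow>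
      measure \<pi> ({x<..} \<times> UNIV) \<le> K * exp (- (g / (32 * \<gamma>) * x))"
    using H_tail_le[OF assms] by blast
  obtain C' where C': "0 < C'" and lower: "\<And>\<pi> x. inert_drift_stationary \<gamma> g \<pi> \<Longrightarrow> 1 \<le> x \<Longrightarrow>
      exp (- C') * exp (- (4 * g * x / \<gamma>)) \<le> measure \<pi> ({x<..} \<times> UNIV)"
    using H_tail_ge[OF assms] by blast
  have up: "measure \<pi> ({x<..} \<times> UNIV) \<le> exp (ln (2 + K)) * exp (- (g * x / (32 * \<gamma>)))"
    if st: "inert_drift_stationary \<gamma> g \<pi>" and x: "1 + x0 < x" for \<pi> x
  proof -
    have "x0 \<le> x" using x by linarith
    from upper[OF st this]
    have "measure \<pi> ({x<..} \<times> UNIV) \<le> K * exp (- (g * x / (32 * \<gamma>)))" by simp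
    also have "\<dots> \<le> exp (ln (2 + K)) * exp (- (g * x / (32 * \<gamma>)))"
      by (intro mult_right_mono le_exp_ln_2_add K) simp
    finally show ?thesis .
  qed
  have low: "exp (- C') * exp (- (4 * g * x / \<gamma>)) \<le> measure \<pi> ({x<..} \<times> UNIV)"
    if "inert_drift_stationary \<gamma> g \<pi>" "1 + x0 < x" for \<pi> x
    using that x0 by (intro lower) auto
  have "0 < 1 + x0" using x0 by simp
  then show "\<exists>x' C' C :: real. x' > 0 \<and> C' > 0 \<and> C > 0 \<and>
      (\<forall>\<pi>. inert_drift_stationary \<gamma> g \<pi> \<longrightarrow> (\<forall>x>x'.
         exp (- C') * exp (- (4 * g * x / \<gamma>)) \<le> measure \<pi> ({x<..} \<times> UNIV) \<and>
         measure \<pi> ({x<..} \<times> UNIV) \<le> exp C * exp (- (g * x / (32 * \<gamma>)))))"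
    using C' le_exp_ln_2_add(1)[OF K] up low by blast
qed

end
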